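(* The fundamental group $\pi_1(M)$ of a strictly causal flat complete Lorentzian manifold $M$ is virtually abelian (i.e. has an abelian subgroup of finite index).
   Context: Setting. $V$ is a real vector space of dimension $n$ with a Lorentzian symmetric bilinear form $\ell$ of signature $(+,-,\dots,-)$. The set $\{v:\ell(v,v)\ge 0\}$ is the union of two closed convex round cones $C$ and $-C$; $C$ is one of them, fixed. A flat complete Lorentzian manifold is a quotient $M=V/\Gamma$ where $\Gamma\cong\pi_1(M)$ is a discrete group acting freely and properly on $V$ by affine transformations $\gamma(v)=\lambda(\gamma)v+\tau(\gamma)$, $\tau(\gamma)\in V$, whose linear parts $\lambda(\gamma)$ preserve $\ell$ and $C$. Let $\kappa:V\to M$ be the quotient map. For $p=\kappa(v)$, the past and the future of $p$ are $P_p=\kappa(v-C)$ and $F_p=\kappa(v+C)$. The cone $C$ induces a field of cones $C_p=d_v\kappa(C)\subset T_pM$. A piecewise smooth path $\eta$ in $M$ is timelike if $\eta'(t)\in C_{\eta(t)}$ for all $t$. $M$ is causal if it admits no nonconstant closed piecewise smooth timelike path; equivalently, $\gamma(v)\in v+C$ with $v\in V$, $\gamma\in\Gamma$ implies $\gamma=e$. $M$ is strictly causal if it is causal and every $p\in M$ has a neighbourhood $U_p$ such that $U_p\cap F_p$ and $U_p\cap P_p$ are closed in $U_p$. *)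

theory Defs
  imports "HOL-Analysis.Analysis" "HOL-Algebra.Coset"
begin

section \<open>Lorentzian forms and time cones\<close>

text \<open>
  The vector space is a type of class \<^class>\<open>euclidean_space\<close>. Its built-in inner product is used
  only through the topology and the differentiable structure, neither of which depends on the choice
  of inner product on a finite-dimensional space.
\<close>

definition lorentzian_form :: "('a::euclidean_space \<Rightarrow> 'a \<Rightarrow> real) \<Rightarrow> bool" where
  "lorentzian_form ell \<longleftrightarrow>
     bilinear ell \<and> (\<forall>x y. ell x y = ell y x) \<and>
     (\<exists>B e. independent B \<and> span B = UNIV \<and> e \<in> B \<and>
        (\<forall>b\<in>B. \<forall>b'\<in>B. b \<noteq> b' \<longrightarrow> ell b b' = 0) \<and>
        ell e e = 1 \<and> (\<forall>b\<in>B - {e}. ell b b = -1))"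

text \<open>
  The condition \<open>C \<inter> -C = {0}\<close> only matters in dimension one, where it excludes the whole line.
\<close>

definition time_cone :: "('a::euclidean_space \<Rightarrow> 'a \<Rightarrow> real) \<Rightarrow> 'a set \<Rightarrow> bool" where
  "time_cone ell C \<longleftrightarrow>
     closed C \<and> convex C \<and> cone C \<and>
     {v. ell v v \<ge> 0} = C \<union> uminus ` C \<and> C \<inter> uminus ` C = {0}"

section \<open>Flat complete Lorentzian manifolds\<close>

definition lorentz_affine ::
    "('a::euclidean_space \<Rightarrow> 'a \<Rightarrow> real) \<Rightarrow> 'a set \<Rightarrow> ('a \<Rightarrow> 'a) \<Rightarrow> bool" where
  "lorentz_affine ell C g \<longleftrightarrow>
     (\<exists>L \<tau>. linear L \<and> (\<forall>v. g v = L v + \<tau>) \<and>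
        (\<forall>x y. ell (L x) (L y) = ell x y) \<and> L ` C = C)"

text \<open>
  A free action on a nonempty space is faithful, so the acting group is identified with a group of
  maps under composition. The last clause is properness of the action of a discrete group.
\<close>

definition acts_freely_properly ::
    "('a::euclidean_space \<Rightarrow> 'a \<Rightarrow> real) \<Rightarrow> 'a set \<Rightarrow> ('a \<Rightarrow> 'a) set \<Rightarrow> bool" where
  "acts_freely_properly ell C \<Gamma> \<longleftrightarrow>
     id \<in> \<Gamma> \<and> (\<forall>g\<in>\<Gamma>. \<forall>h\<in>\<Gamma>. g \<circ> h \<in> \<Gamma>) \<and> (\<forall>g\<in>\<Gamma>. bij g \<and> inv_into UNIV g \<in> \<Gamma>) \<and>
     (\<forall>g\<in>\<Gamma>. lorentz_affine ell C g) \<and>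
     (\<forall>g\<in>\<Gamma>. \<forall>v. g v = v \<longrightarrow> g = id) \<and>
     (\<forall>K. compact K \<longrightarrow> finite {g \<in> \<Gamma>. g ` K \<inter> K \<noteq> {}})"

definition orbit_map :: "('a \<Rightarrow> 'a) set \<Rightarrow> 'a \<Rightarrow> 'a set" where
  "orbit_map \<Gamma> v = (\<lambda>g. g v) ` \<Gamma>"

definition orbit_space :: "('a::topological_space \<Rightarrow> 'a) set \<Rightarrow> 'a set topology" where
  "orbit_space \<Gamma> =
     topology (\<lambda>U. U \<subseteq> range (orbit_map \<Gamma>) \<and> open (orbit_map \<Gamma> -` U))"

lemma openin_orbit_space:
  "openin (orbit_space \<Gamma>) U \<longleftrightarrow> U \<subseteq> range (orbit_map \<Gamma>) \<and> open (orbit_map \<Gamma> -` U)"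
proof -
  have "istopology (\<lambda>U. U \<subseteq> range (orbit_map \<Gamma>) \<and> open (orbit_map \<Gamma> -` U))"
    unfolding istopology_def by (auto simp: vimage_Union)
  then show ?thesis
    by (simp add: orbit_space_def topology_inverse')
qed

lemma topspace_orbit_space: "topspace (orbit_space \<Gamma>) = range (orbit_map \<Gamma>)"
proof
  show "topspace (orbit_space \<Gamma>) \<subseteq> range (orbit_map \<Gamma>)"
    by (auto simp: topspace_def openin_orbit_space)
  have "orbit_map \<Gamma> -` range (orbit_map \<Gamma>) = UNIV" by auto
  then have "openin (orbit_space \<Gamma>) (range (orbit_map \<Gamma>))"
    by (simp add: openin_orbit_space)
  then show "range (orbit_map \<Gamma>) \<subseteq> topspace (orbit_space \<Gamma>)"
    by (rule openin_subset)
qed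

lemma quotient_map_orbit_map: "quotient_map euclidean (orbit_space \<Gamma>) (orbit_map \<Gamma>)"
  unfolding quotient_map_def
  by (auto simp: topspace_orbit_space openin_orbit_space vimage_def)

section \<open>Causality\<close>

definition smooth_on_interval :: "(real \<Rightarrow> 'a::real_normed_vector) \<Rightarrow> real \<Rightarrow> real \<Rightarrow> bool" where
  "smooth_on_interval c a b \<longleftrightarrow>
     (\<exists>d :: nat \<Rightarrow> real \<Rightarrow> 'a. d 0 = c \<and>
        (\<forall>k. \<forall>t\<in>{a..b}. (d k has_vector_derivative d (Suc k) t) (at t within {a..b})))"

text \<open>
  \<open>S\<close> is the finite set of break points. At a break point both one-sided derivatives are required
  to lie in \<open>C\<close>.
\<close>

definition piecewise_smooth_timelike ::
    "'a::real_normed_vector set \<Rightarrow> (real \<Rightarrow> 'a) \<Rightarrow> real \<Rightarrow> real \<Rightarrow> bool" where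
  "piecewise_smooth_timelike C c a b \<longleftrightarrow>
     continuous_on {a..b} c \<and>
     (\<exists>S. finite S \<and>
        (\<forall>u v. a \<le> u \<and> u < v \<and> v \<le> b \<and> {u<..<v} \<inter> S = {} \<longrightarrow>
           smooth_on_interval c u v \<and>
           (\<forall>t\<in>{u..v}. \<exists>w\<in>C. (c has_vector_derivative w) (at t within {u..v}))))"

text \<open>
  The local inverses of the orbit map are the charts of the quotient manifold. Accordingly, a path
  in the quotient is piecewise smooth if it locally lifts to piecewise smooth curves, and its
  tangent vector lies in the image of \<open>C\<close> under the differential of the orbit map iff the tangent
  vector of a local lift lies in \<open>C\<close>; the choice of lift is immaterial because the linear parts
  of the group preserve \<open>C\<close>.
\<close>

definition timelike_path ::
    "('a::euclidean_space \<Rightarrow> 'a) set \<Rightarrow> 'a set \<Rightarrow> (real \<Rightarrow> 'a set) \<Rightarrow> bool" where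
  "timelike_path \<Gamma> C \<eta> \<longleftrightarrow>
     pathin (orbit_space \<Gamma>) \<eta> \<and>
     (\<forall>t\<in>{0..1}. \<exists>\<epsilon>>0. \<exists>c.
        piecewise_smooth_timelike C c (max 0 (t - \<epsilon>)) (min 1 (t + \<epsilon>)) \<and>
        (\<forall>s\<in>{max 0 (t - \<epsilon>)..min 1 (t + \<epsilon>)}. \<eta> s = orbit_map \<Gamma> (c s)))"

definition causal :: "('a::euclidean_space \<Rightarrow> 'a) set \<Rightarrow> 'a set \<Rightarrow> bool" where
  "causal \<Gamma> C \<longleftrightarrow>
     \<not> (\<exists>\<eta>. timelike_path \<Gamma> C \<eta> \<and> \<eta> 0 = \<eta> 1 \<and> (\<exists>t\<in>{0..1}. \<eta> t \<noteq> \<eta> 0))"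

text \<open>
  Past and future of the point \<open>orbit_map \<Gamma> v\<close>; they depend only on that point, since the linear
  parts of the group preserve \<open>C\<close>.
\<close>

definition past_of :: "('a::euclidean_space \<Rightarrow> 'a) set \<Rightarrow> 'a set \<Rightarrow> 'a \<Rightarrow> 'a set set" where
  "past_of \<Gamma> C v = orbit_map \<Gamma> ` {v - w | w. w \<in> C}"

definition future_of :: "('a::euclidean_space \<Rightarrow> 'a) set \<Rightarrow> 'a set \<Rightarrow> 'a \<Rightarrow> 'a set set" where
  "future_of \<Gamma> C v = orbit_map \<Gamma> ` {v + w | w. w \<in> C}"

definition strictly_causal :: "('a::euclidean_space \<Rightarrow> 'a) set \<Rightarrow> 'a set \<Rightarrow> bool" where
  "strictly_causal \<Gamma> C \<longleftrightarrow>
     causal \<Gamma> C \<and>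
     (\<forall>v. \<exists>U W. U \<subseteq> topspace (orbit_space \<Gamma>) \<and>
        openin (orbit_space \<Gamma>) W \<and> orbit_map \<Gamma> v \<in> W \<and> W \<subseteq> U \<and>
        closedin (subtopology (orbit_space \<Gamma>) U) (U \<inter> future_of \<Gamma> C v) \<and>
        closedin (subtopology (orbit_space \<Gamma>) U) (U \<inter> past_of \<Gamma> C v))"

section \<open>The fundamental group\<close>

definition loops_at :: "'b topology \<Rightarrow> 'b \<Rightarrow> (real \<Rightarrow> 'b) set" where
  "loops_at X p = {f. pathin X f \<and> f 0 = p \<and> f 1 = p}"

definition loop_homotopy :: "'b topology \<Rightarrow> 'b \<Rightarrow> ((real \<Rightarrow> 'b) \<times> (real \<Rightarrow> 'b)) set" where
  "loop_homotopy X p =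
     {(f, g). f \<in> loops_at X p \<and> g \<in> loops_at X p \<and>
        homotopic_with (\<lambda>h. h 0 = p \<and> h 1 = p) (top_of_set {0..1}) X f g}"

text \<open>
  Same formula as the library's \<^const>\<open>joinpaths\<close>, whose type demands a type class topology on
  the codomain.
\<close>

definition concat_paths :: "(real \<Rightarrow> 'b) \<Rightarrow> (real \<Rightarrow> 'b) \<Rightarrow> real \<Rightarrow> 'b" where
  "concat_paths f g = (\<lambda>t. if t \<le> 1/2 then f (2 * t) else g (2 * t - 1))"

definition fundamental_group :: "'b topology \<Rightarrow> 'b \<Rightarrow> (real \<Rightarrow> 'b) set monoid" where
  "fundamental_group X p =
     \<lparr>carrier = loops_at X p // loop_homotopy X p,
      mult = (\<lambda>A B. \<Union>f\<in>A. \<Union>g\<in>B. loop_homotopy X p `` {concat_paths f g}),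
      one = loop_homotopy X p `` {\<lambda>_. p}\<rparr>"

definition virtually_abelian :: "('g, 'm) monoid_scheme \<Rightarrow> bool" where
  "virtually_abelian G \<longleftrightarrow>
     group G \<and>
     (\<exists>H. subgroup H G \<and> comm_group (G\<lparr>carrier := H\<rparr>) \<and> finite (rcosets\<^bsub>G\<^esub> H))"

end

theory Submission
  imports Defs "HOL-Algebra.Generated_Groups"
begin

text \<open>
  Causality makes every displacement \<open>g v - v\<close> spacelike, and strict causality bounds these vectors
  away from the light cone. Since \<open>g v - v\<close> is affine in \<open>v\<close>, its linear part \<open>\<lambda>(g) v - v\<close> is never
  timelike, so no linear part is hyperbolic. Hence the linear parts fix a common nonzero vector in
  the cone: a timelike one if they form a bounded set, otherwise a lightlike vector \<open>\<xi>\<close> obtained from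
  a limit of normalised linear parts.

  In the first case the group acts by Euclidean isometries. In the second case it acts on
  \<open>V / \<real>\<xi> = \<real> \<times> E\<close> by \<open>(q, e) \<mapsto> (q + a, A e + q b + c)\<close> with \<open>A\<close> orthogonal; strict causality says
  that elements with \<open>a = 0\<close> move the origin by at least some \<open>\<delta> > 0\<close>, and causality says that
  \<open>a \<noteq> 0\<close> forces \<open>b\<close> into the range of \<open>A - 1\<close>. As in Bieberbach's theorem, iterated commutators of
  two elements with small rotation part converge to, hence reach, the identity; the two properties
  then force the elements to commute. Elements with small rotation generate a subgroup of finite
  index, as the orthogonal group is compact. Finally, the fundamental group is a quotient of the deck
  group because \<open>V\<close> is convex.
\<close>

section \<open>Groups of affine maps with orthogonal rotation part\<close>

text \<open>Properness of the action on \<open>V\<close> does not by itself pass to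
  \<open>V / \<real>\<xi>\<close>; the gap \<open>\<delta>\<close> takes the place of discreteness.
  It covers only elements with \<open>a = 0\<close>, which suffices because \<open>a\<close>
  vanishes on every commutator. The gap alone does not force commutativity: with trivial rotations
  the commutator of two elements is a translation of the form \<open>a' b - a b'\<close>, and the
  discrete Heisenberg group acts in this way with a gap. What excludes this is that causality puts
  shears into the range of \<open>A - 1\<close>, hence makes them orthogonal to every vector fixed
  by the rotation. A shear is controlled only where \<open>a \<noteq> 0\<close>, which is why the
  final argument has to watch \<open>a\<close>.\<close>

lemma orthogonal_fixed_inner:
  assumes "orthogonal_transformation f" "f w = w"
  shows "w \<bullet> (f y - y) = 0"
proof -
  have "w \<bullet> f y = f w \<bullet> f y" using assms by simp
  also have "\<dots> = w \<bullet> y" using assms(1) by (simp add: orthogonal_transformation_def)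
  finally show ?thesis by (simp add: inner_diff_right)
qed

lemma orthogonal_transformation_funpow:
  fixes f :: "'a::real_inner \<Rightarrow> 'a"
  shows "orthogonal_transformation f \<Longrightarrow> orthogonal_transformation (f ^^ n)"
proof (induction n)
  case 0
  then show ?case using orthogonal_transformation_id by (simp add: id_def)
next
  case (Suc n)
  then show ?case
    using orthogonal_transformation_compose[of f "f ^^ n"] by (simp add: comp_def)
qed

text \<open>Doubling the exponent nearly doubles a small displacement, so the powers of an isometry other
  than the identity cannot all stay close to the identity.\<close>

lemma orthogonal_powers_near_id:
  fixes X :: "'a::euclidean_space \<Rightarrow> 'a"
  assumes X: "orthogonal_transformation X"
    and near: "\<And>n x. norm ((X ^^ n) x - x) \<le> norm x / 4"
  shows "X x = x"
proof (rule ccontr)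
  assume "X x \<noteq> x"
  then have pos: "norm (X x - x) > 0" by simp
  have grow: "(7/4) ^ k * norm (X x - x) \<le> norm ((X ^^ (2 ^ k)) x - x)" for k
  proof (induction k)
    case (Suc k)
    define Y where "Y = X ^^ (2 ^ k)"
    have lin: "linear Y"
      unfolding Y_def using orthogonal_transformation_funpow[OF X]
      by (simp add: orthogonal_transformation_linear)
    have "(X ^^ (2 ^ Suc k)) x = Y (Y x)"
      by (simp add: Y_def mult_2 funpow_add)
    then have "(X ^^ (2 ^ Suc k)) x - x = 2 *\<^sub>R (Y x - x) + (Y (Y x - x) - (Y x - x))"
      by (simp add: linear_diff[OF lin] scaleR_2)
    then have "norm ((X ^^ (2 ^ Suc k)) x - x)
        \<ge> norm (2 *\<^sub>R (Y x - x)) - norm (Y (Y x - x) - (Y x - x))"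
      using norm_triangle_ineq2[of "2 *\<^sub>R (Y x - x)" "- (Y (Y x - x) - (Y x - x))"]
      by (metis diff_minus_eq_add norm_minus_cancel)
    moreover have "norm (Y (Y x - x) - (Y x - x)) \<le> norm (Y x - x) / 4"
      unfolding Y_def by (rule near)
    ultimately show ?case using Suc unfolding Y_def by simp
  qed simp
  obtain k where "norm x / norm (X x - x) < (7/4) ^ k"
    using real_arch_pow[of "7/4"] by auto
  with pos have "norm x < (7/4) ^ k * norm (X x - x)" by (simp add: field_simps)
  also have "\<dots> \<le> norm x / 4" using grow[of k] near[of "2^k" x] by linarith
  finally show False using norm_ge_zero[of x] by linarith
qed

text \<open>As \<open>X\<close> commutes with \<open>B\<close>, the power \<open>X ^^ n\<close> is
  the commutator of \<open>B ^^ n\<close> with \<open>U\<close>. Such a commutator is at most twice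
  as far from the identity as \<open>U\<close>, whence the bound \<open>1/4\<close> for every
  \<open>n\<close>.\<close>

lemma commutator_trivial_if_central:
  fixes U :: "'a::euclidean_space \<Rightarrow> 'a"
  assumes U: "orthogonal_transformation U" and B: "orthogonal_transformation B"
    and X: "orthogonal_transformation X"
    and comm: "\<And>x. X (U (B x)) = B (U x)" and central: "\<And>x. X (B x) = B (X x)"
    and small: "\<And>x. norm (U x - x) \<le> norm x / 8"
  shows "X x = x"
proof (rule orthogonal_powers_near_id[OF X])
  fix n x
  have XnB: "(X ^^ n) (B z) = B ((X ^^ n) z)" for n z
    by (induction n) (simp_all add: central)
  have power: "(X ^^ n) (U ((B ^^ n) z)) = (B ^^ n) (U z)" for n z
  proof (induction n)
    case (Suc n)
    have "(X ^^ Suc n) (U ((B ^^ Suc n) z)) = (X ^^ n) (X (U (B ((B ^^ n) z))))"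
      by (simp add: funpow_swap1)
    also have "\<dots> = B ((X ^^ n) (U ((B ^^ n) z)))" by (simp add: comm XnB)
    finally show ?case using Suc by simp
  qed simp
  have Bn: "orthogonal_transformation (B ^^ n)" by (rule orthogonal_transformation_funpow[OF B])
  then obtain z where z: "x = U ((B ^^ n) z)"
    using U by (metis orthogonal_transformation_surj surjD)
  have nz: "norm x = norm z"
    using z U Bn by (simp add: orthogonal_transformation_norm)
  have "(X ^^ n) x - x = (B ^^ n) (U z - z) - (U ((B ^^ n) z) - (B ^^ n) z)"
    using Bn by (simp add: z power linear_diff orthogonal_transformation_linear)
  then have "norm ((X ^^ n) x - x) \<le> norm ((B ^^ n) (U z - z)) + norm (U ((B ^^ n) z) - (B ^^ n) z)"
    by (simp add: norm_triangle_ineq4)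
  also have "\<dots> \<le> norm z / 8 + norm ((B ^^ n) z) / 8"
    using small[of z] small[of "(B ^^ n) z"] Bn by (simp add: orthogonal_transformation_norm)
  finally show "norm ((X ^^ n) x - x) \<le> norm x / 4"
    using Bn by (simp add: nz orthogonal_transformation_norm)
qed

lemma geometric_decay:
  fixes x :: "nat \<Rightarrow> real"
  assumes "\<And>k. x (Suc k) \<le> x k / 4 + K * (1/2) ^ k" "K \<ge> 0"
  shows "\<exists>K'\<ge>0. \<forall>k. x k \<le> K' * (1/2) ^ k"
proof -
  \<comment> \<open>The summand \<open>4 * K\<close> makes \<open>K' / 4 + K \<le> K' / 2\<close>;
    the summand \<open>\<bar>x 0\<bar>\<close> starts the induction.\<close>
  define K' where "K' = 4 * K + \<bar>x 0\<bar>"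
  have "x k \<le> K' * (1/2) ^ k" for k
  proof (induction k)
    case (Suc k)
    have "x (Suc k) \<le> (K' / 4 + K) * (1/2) ^ k" using assms(1)[of k] Suc by (simp add: algebra_simps)
    also have "\<dots> \<le> (K' / 2) * (1/2) ^ k" by (rule mult_right_mono) (auto simp: K'_def)
    finally show ?case by simp
  qed (use assms in \<open>simp add: K'_def\<close>)
  then show ?thesis using assms(2) by (intro exI[of _ K']) (auto simp: K'_def)
qed

text \<open>The group acts on \<open>\<real> \<times> E\<close> by \<open>(q, e) \<mapsto> (q + a g, A g e + q b g + c g)\<close>; the laws below say
  that composition of these maps corresponds to the multiplication of the group.\<close>

locale horospherical_action = group G for G (structure) +
  fixes A :: "'g \<Rightarrow> 'a::euclidean_space \<Rightarrow> 'a" and a :: "'g \<Rightarrow> real" and b c :: "'g \<Rightarrow> 'a"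
    and \<delta> :: real
  assumes orth: "g \<in> carrier G \<Longrightarrow> orthogonal_transformation (A g)"
    and A_mult: "\<lbrakk>g \<in> carrier G; h \<in> carrier G\<rbrakk> \<Longrightarrow> A (g \<otimes> h) x = A g (A h x)"
    and a_mult: "\<lbrakk>g \<in> carrier G; h \<in> carrier G\<rbrakk> \<Longrightarrow> a (g \<otimes> h) = a g + a h"
    and b_mult: "\<lbrakk>g \<in> carrier G; h \<in> carrier G\<rbrakk> \<Longrightarrow> b (g \<otimes> h) = A g (b h) + b g"
    and c_mult: "\<lbrakk>g \<in> carrier G; h \<in> carrier G\<rbrakk> \<Longrightarrow> c (g \<otimes> h) = A g (c h) + a h *\<^sub>R b g + c g"
    and \<delta>_pos: "\<delta> > 0"
    and separated: "\<lbrakk>g \<in> carrier G; g \<noteq> \<one>; a g = 0\<rbrakk> \<Longrightarrow> \<delta> \<le> norm (c g)"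
    and shear_in_range: "\<lbrakk>g \<in> carrier G; a g \<noteq> 0\<rbrakk> \<Longrightarrow> \<exists>y. b g = A g y - y"
begin

lemma linA: "g \<in> carrier G \<Longrightarrow> linear (A g)"
  by (simp add: orth orthogonal_transformation_linear)

lemma normA: "g \<in> carrier G \<Longrightarrow> norm (A g x) = norm x"
  by (simp add: orth orthogonal_transformation_norm)

lemma A_one: "A \<one> x = x"
proof -
  have "A \<one> (A \<one> x - x) = 0" using A_mult[of \<one> \<one> x] by (simp add: linear_diff[OF linA])
  then have "norm (A \<one> x - x) = 0" using normA[of \<one> "A \<one> x - x"] by simp
  then show ?thesis by simp
qed

lemma a_one: "a \<one> = 0" using a_mult[of \<one> \<one>] by simp

lemma b_one: "b \<one> = 0" using b_mult[of \<one> \<one>] by (simp add: A_one)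

lemma c_one: "c \<one> = 0" using c_mult[of \<one> \<one>] by (simp add: A_one a_one)

text \<open>With the threshold \<open>1/8\<close>, commutation with a small element contracts by
  \<open>2 * 1/8 = 1/4\<close>; it is also the bound that
  \<open>commutator_trivial_if_central\<close> asks for.\<close>

definition small :: "'g \<Rightarrow> bool" where
  "small g \<longleftrightarrow> g \<in> carrier G \<and> (\<forall>x. norm (A g x - x) \<le> norm x / 8)"

section \<open>Nested commutators and their rotation, shear and translation parts\<close>

definition comm :: "'g \<Rightarrow> 'g \<Rightarrow> 'g" where
  "comm \<psi> x = \<psi> \<otimes> x \<otimes> inv \<psi> \<otimes> inv x"

abbreviation nested :: "'g \<Rightarrow> 'g \<Rightarrow> nat \<Rightarrow> 'g" where
  "nested \<psi> \<phi> k \<equiv> (comm \<psi> ^^ k) \<phi>"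

lemma comm_closed [simp]: "\<lbrakk>\<psi> \<in> carrier G; x \<in> carrier G\<rbrakk> \<Longrightarrow> comm \<psi> x \<in> carrier G"
  by (simp add: comm_def)

lemma nested_closed [simp]:
  "\<lbrakk>\<psi> \<in> carrier G; \<phi> \<in> carrier G\<rbrakk> \<Longrightarrow> nested \<psi> \<phi> k \<in> carrier G"
  by (induction k) auto

text \<open>With the inverses multiplied away, the composition laws yield the parts of a commutator
  without formulas for \<open>A\<close>, \<open>b\<close> and \<open>c\<close> at inverses.\<close>

lemma comm_mult: "\<lbrakk>\<psi> \<in> carrier G; x \<in> carrier G\<rbrakk> \<Longrightarrow> comm \<psi> x \<otimes> (x \<otimes> \<psi>) = \<psi> \<otimes> x"
  by (simp add: comm_def m_assoc) (simp add: m_assoc[symmetric])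

lemma comm_eq_one: "\<lbrakk>\<psi> \<in> carrier G; x \<in> carrier G; comm \<psi> x = \<one>\<rbrakk> \<Longrightarrow> x \<otimes> \<psi> = \<psi> \<otimes> x"
  using comm_mult[of \<psi> x] by simp

context
  fixes \<psi> x
  assumes \<psi>[simp]: "\<psi> \<in> carrier G" and x[simp]: "x \<in> carrier G"
begin

lemma A_comm: "A (comm \<psi> x) (A x (A \<psi> z)) = A \<psi> (A x z)"
  using comm_mult[OF \<psi> x] A_mult \<psi> x by (metis comm_closed m_closed)

lemma a_comm: "a (comm \<psi> x) = 0"
  using arg_cong[OF comm_mult[OF \<psi> x], of a] by (simp add: a_mult)

lemma b_comm: "b (comm \<psi> x) =
    A \<psi> (b x) - A (comm \<psi> x) (b x) + (b \<psi> - A (comm \<psi> x) (A x (b \<psi>)))"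
  using arg_cong[OF comm_mult[OF \<psi> x], of b]
  by (simp add: b_mult linear_add[OF linA] algebra_simps)

lemma c_comm: "c (comm \<psi> x) =
    A \<psi> (c x) - A (comm \<psi> x) (c x) + (c \<psi> - A (comm \<psi> x) (A x (c \<psi>)))
    + a x *\<^sub>R b \<psi> - a \<psi> *\<^sub>R A (comm \<psi> x) (b x) - (a x + a \<psi>) *\<^sub>R b (comm \<psi> x)"
  using arg_cong[OF comm_mult[OF \<psi> x], of c]
  by (simp add: c_mult a_mult linear_add[OF linA] linear_scale[OF linA] algebra_simps)

end

text \<open>Up to an isometry on the right, the commutator minus the identity is
  \<open>(A \<psi> - 1)(A x - 1) - (A x - 1)(A \<psi> - 1)\<close>, and each product contributes at
  most \<open>u / 8\<close>.\<close>

lemma A_comm_decay: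
  assumes "small \<psi>" "x \<in> carrier G" "\<And>z. norm (A x z - z) \<le> u * norm z"
  shows "norm (A (comm \<psi> x) z - z) \<le> u / 4 * norm z"
proof -
  have \<psi>[simp]: "\<psi> \<in> carrier G" and s: "norm (A \<psi> z - z) \<le> norm z / 8" for z
    using assms(1) by (auto simp: small_def)
  note x = assms(2)
  obtain y where y: "z = A x (A \<psi> y)"
    using orth[OF x] orth[OF \<psi>] by (metis orthogonal_transformation_surj surjD)
  have nz: "norm z = norm y" using y x by (simp add: normA)
  have "A (comm \<psi> x) z - z
      = (A \<psi> (A x y - y) - (A x y - y)) - (A x (A \<psi> y - y) - (A \<psi> y - y))"
    using x by (simp add: y A_comm linear_diff[OF linA])
  then have "norm (A (comm \<psi> x) z - z)
      \<le> norm (A \<psi> (A x y - y) - (A x y - y)) + norm (A x (A \<psi> y - y) - (A \<psi> y - y))"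
    by (metis norm_triangle_ineq4)
  also have "\<dots> \<le> norm (A x y - y) / 8 + u * norm (A \<psi> y - y)"
    using s assms(3) by (intro add_mono) auto
  also have "\<dots> \<le> u * norm y / 8 + u * (norm y / 8)"
  proof -
    have "u * norm (A \<psi> y - y) \<le> u * (norm y / 8)"
    proof (cases "y = 0")
      case False
      have "0 \<le> u * norm y" using assms(3)[of y] norm_ge_zero order_trans by blast
      then have "u \<ge> 0" using False by (simp add: zero_le_mult_iff)
      then show ?thesis using s[of y] by (rule mult_left_mono[rotated])
    qed (simp add: linear_0[OF linA])
    then show ?thesis using assms(3)[of y] by simp
  qed
  finally show ?thesis by (simp add: nz)
qed

text \<open>Rotations decay geometrically; the recursions for \<open>b\<close> and then for
  \<open>c\<close> contract by \<open>1/4\<close> up to errors controlled by the parts already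
  treated. Once \<open>c\<close> is shorter than \<open>\<delta>\<close>, \<open>separated\<close>
  leaves only the identity.\<close>

lemma nested_eq_one:
  assumes \<psi>: "small \<psi>" and \<phi>: "small \<phi>"
  shows "\<exists>N. nested \<psi> \<phi> N = \<one>"
proof -
  have [simp]: "\<psi> \<in> carrier G" "\<phi> \<in> carrier G" using assms by (auto simp: small_def)
  define F where "F = nested \<psi> \<phi>"
  have F[simp]: "F k \<in> carrier G" for k by (simp add: F_def)
  have F_Suc: "F (Suc k) = comm \<psi> (F k)" for k by (simp add: F_def)
  have rot: "norm (A (F k) z - z) \<le> (1/8 * (1/4) ^ k) * norm z" for k z
  proof (induction k arbitrary: z)
    case 0 then show ?case using \<phi> by (simp add: F_def small_def)
  next
    case (Suc k)
    show ?case using A_comm_decay[OF \<psi> F Suc, of z] by (simp add: F_Suc)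
  qed
  \<comment> \<open>Errors of order \<open>(1/4) ^ k\<close>, the contraction rate itself, could
    accumulate to \<open>k * (1/4) ^ k\<close>; the weaker rate keeps the decay geometric.\<close>
  have rot': "norm (A (F k) z - z) \<le> 1/8 * (1/2) ^ k * norm z" for k z
  proof -
    have "(1/4::real) ^ k \<le> (1/2) ^ k" by (rule power_mono) auto
    then have "1/8 * (1/4) ^ k * norm z \<le> 1/8 * (1/2) ^ k * norm z"
      by (intro mult_right_mono) auto
    then show ?thesis using rot[of k z] by linarith
  qed
  have rot1: "norm (A (F k) z - z) \<le> norm z / 8" for k z
  proof -
    have "(1/2::real) ^ k \<le> 1" by (simp add: power_le_one)
    then have "1/8 * (1/2) ^ k * norm z \<le> 1/8 * 1 * norm z"
      by (intro mult_right_mono mult_left_mono) auto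
    then show ?thesis using rot'[of k z] by simp
  qed
  have s: "norm (A \<psi> z - z) \<le> norm z / 8" for z using \<psi> by (simp add: small_def)
  have diff: "norm (A \<psi> z - A (F k) z) \<le> norm z / 4" for k z
    using norm_triangle_ineq4[of "A \<psi> z - z" "A (F k) z - z"] s[of z] rot1[of k z] by simp
  have two: "norm (z - A (F (Suc k)) (A (F k) z)) \<le> norm z * (1/2) ^ k" for k z
  proof -
    have "norm (z - A (F (Suc k)) (A (F k) z))
        \<le> norm (A (F k) z - z) + norm (A (F (Suc k)) (A (F k) z) - A (F k) z)"
      using norm_triangle_ineq[of "A (F k) z - z" "A (F (Suc k)) (A (F k) z) - A (F k) z"]
      by (simp add: norm_minus_commute)
    also have "\<dots> \<le> 1/8 * (1/2) ^ k * norm z + 1/8 * (1/2) ^ Suc k * norm (A (F k) z)"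
      by (rule add_mono[OF rot' rot'])
    also have "\<dots> \<le> norm z * (1/2) ^ k" by (simp add: normA field_simps)
    finally show ?thesis .
  qed
  have "norm (b (F (Suc k))) \<le> norm (b (F k)) / 4 + norm (b \<psi>) * (1/2) ^ k" for k
  proof -
    have "b (F (Suc k)) = (A \<psi> (b (F k)) - A (F (Suc k)) (b (F k)))
        + (b \<psi> - A (F (Suc k)) (A (F k) (b \<psi>)))"
      using b_comm[of \<psi> "F k"] by (simp add: F_Suc)
    then have "norm (b (F (Suc k))) \<le> norm (A \<psi> (b (F k)) - A (F (Suc k)) (b (F k)))
        + norm (b \<psi> - A (F (Suc k)) (A (F k) (b \<psi>)))"
      by (simp add: norm_triangle_ineq)
    then show ?thesis
      using diff[of "b (F k)" "Suc k"] two[of "b \<psi>" k] by linarith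
  qed
  from geometric_decay[of "\<lambda>k. norm (b (F k))", OF this]
  obtain Kb where Kb: "Kb \<ge> 0" "\<And>k. norm (b (F k)) \<le> Kb * (1/2) ^ k" by auto
  have aF: "a (F (Suc j)) = 0" for j by (simp add: F_Suc a_comm)
  \<comment> \<open>The summand \<open>a x *\<^sub>R b \<psi>\<close> of \<open>c_comm\<close> need
    not decay. It vanishes from the first commutator on, so the recursion starts at index
    \<open>Suc k\<close>.\<close>
  have "norm (c (F (Suc (Suc k)))) \<le> norm (c (F (Suc k))) / 4
      + (norm (c \<psi>) + 2 * \<bar>a \<psi>\<bar> * Kb) * (1/2) ^ k" for k
  proof -
    let ?k = "Suc k"
    have eq: "c (F (Suc ?k)) = (A \<psi> (c (F ?k)) - A (F (Suc ?k)) (c (F ?k)))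
        + (c \<psi> - A (F (Suc ?k)) (A (F ?k) (c \<psi>)))
        - (a \<psi> *\<^sub>R A (F (Suc ?k)) (b (F ?k)) + a \<psi> *\<^sub>R b (F (Suc ?k)))"
      using c_comm[of \<psi> "F ?k"] by (simp add: F_Suc[of ?k] aF)
    have half: "(1/2::real) ^ ?k \<le> (1/2) ^ k" "(1/2::real) ^ Suc ?k \<le> (1/2) ^ k"
      by (simp_all add: field_simps)
    have b1: "norm (a \<psi> *\<^sub>R A (F (Suc ?k)) (b (F ?k))) \<le> \<bar>a \<psi>\<bar> * (Kb * (1/2) ^ k)"
      using order_trans[OF Kb(2)[of ?k] mult_left_mono[OF half(1) Kb(1)]]
      by (simp add: normA mult_left_mono)
    have b2: "norm (a \<psi> *\<^sub>R b (F (Suc ?k))) \<le> \<bar>a \<psi>\<bar> * (Kb * (1/2) ^ k)"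
      using order_trans[OF Kb(2)[of "Suc ?k"] mult_left_mono[OF half(2) Kb(1)]]
      by (simp add: mult_left_mono)
    have c1: "norm (c \<psi> - A (F (Suc ?k)) (A (F ?k) (c \<psi>))) \<le> norm (c \<psi>) * (1/2) ^ k"
      by (rule order_trans[OF two mult_left_mono[OF half(1)]]) simp
    have "norm (c (F (Suc ?k))) \<le> norm (A \<psi> (c (F ?k)) - A (F (Suc ?k)) (c (F ?k)))
        + norm (c \<psi> - A (F (Suc ?k)) (A (F ?k) (c \<psi>)))
        + (norm (a \<psi> *\<^sub>R A (F (Suc ?k)) (b (F ?k))) + norm (a \<psi> *\<^sub>R b (F (Suc ?k))))"
      unfolding eq by (meson add_mono norm_triangle_ineq norm_triangle_ineq4 order_trans order_refl)
    then show ?thesis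
      using diff[of "c (F ?k)" "Suc ?k"] b1 b2 c1 by (simp add: algebra_simps)
  qed
  from geometric_decay[of "\<lambda>k. norm (c (F (Suc k)))", OF this]
  obtain K where K: "K \<ge> 0" "\<And>k. norm (c (F (Suc k))) \<le> K * (1/2) ^ k" using Kb(1) by auto
  have "(\<lambda>k. K * (1/2) ^ k) \<longlonglongrightarrow> K * 0"
    by (intro tendsto_mult tendsto_const LIMSEQ_power_zero) simp
  then have "\<forall>\<^sub>F k in sequentially. K * (1/2) ^ k < \<delta>"
    using \<delta>_pos by (intro order_tendstoD(2)[where y = "K * 0"]) auto
  then obtain k where "K * (1/2) ^ k < \<delta>" by (meson eventually_happens' sequentially_bot)
  then have "norm (c (F (Suc k))) < \<delta>" using K(2)[of k] by linarith
  then have "F (Suc k) = \<one>" using separated[of "F (Suc k)"] aF[of k] by force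
  then show ?thesis unfolding F_def by blast
qed

lemma nested_small:
  assumes "small \<psi>" "small \<phi>"
  shows "small (nested \<psi> \<phi> k)"
proof (induction k)
  case (Suc k)
  have "norm (A (comm \<psi> (nested \<psi> \<phi> k)) z - z) \<le> norm z / 8" for z
    using A_comm_decay[OF assms(1), of "nested \<psi> \<phi> k" "1/8" z] Suc norm_ge_zero[of z]
    by (simp add: small_def del: norm_ge_zero)
  then show ?case
    using assms by (simp add: small_def)
qed (use assms in simp)

text \<open>Descending induction from \<open>N\<close>: if the next commutator has trivial rotation,
  then the present rotation commutes with \<open>A \<psi>\<close>; being itself a commutator of
  \<open>A \<psi>\<close> with a small rotation, it is trivial. The case \<open>k = 0\<close> is
  excluded because \<open>\<phi>\<close> need not be such a commutator.\<close>

lemma nested_rotation_trivial: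
  assumes \<psi>: "small \<psi>" and \<phi>: "small \<phi>" and N: "nested \<psi> \<phi> N = \<one>" and k: "0 < k" "k \<le> N"
  shows "A (nested \<psi> \<phi> k) z = z"
proof -
  have [simp]: "\<psi> \<in> carrier G" "\<phi> \<in> carrier G" using assms by (auto simp: small_def)
  have "\<forall>z. A (nested \<psi> \<phi> (Suc j)) z = z" if "Suc j \<le> N" for j
    using that
  proof (induction "N - Suc j" arbitrary: j)
    case 0
    then show ?case using N by (metis A_one diff_is_0_eq le_antisym)
  next
    case (Suc n)
    let ?U = "nested \<psi> \<phi> j" and ?X = "nested \<psi> \<phi> (Suc j)"
    have "\<forall>z. A (comm \<psi> ?X) z = z"
      using Suc(1)[of "Suc j"] Suc(2) by simp
    then have central: "A ?X (A \<psi> z) = A \<psi> (A ?X z)" for z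
      using A_comm[of \<psi> ?X z] by simp
    have "A ?X z = z" for z
      using commutator_trivial_if_central[of "A ?U" "A \<psi>" "A ?X" z] orth
        A_comm[of \<psi> ?U] central nested_small[OF \<psi> \<phi>, of j] by (simp add: small_def)
    then show ?case by blast
  qed
  then show ?thesis using k by (cases k) auto
qed

text \<open>Commutation with \<open>\<rho>\<close> acts on the translation part of
  \<open>\<omega>\<close> by \<open>D = A \<rho> - 1\<close>. Some nested commutator is trivial, so
  a power of \<open>D\<close> kills \<open>c \<omega>\<close>; kernel and range of \<open>D\<close>
  are orthogonal, so \<open>D\<close> itself does.\<close>

lemma fixed_if_nested_translation:
  assumes \<rho>: "small \<rho>" and \<omega>: "\<omega> \<in> carrier G" "\<And>z. A \<omega> z = z" "a \<omega> = 0"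
    and ab: "a \<rho> *\<^sub>R b \<omega> = 0"
  shows "A \<rho> (c \<omega>) = c \<omega>"
proof -
  have [simp]: "\<rho> \<in> carrier G" "\<omega> \<in> carrier G" using assms by (auto simp: small_def)
  have "small \<omega>" using \<omega> by (simp add: small_def)
  then obtain N where N: "nested \<rho> \<omega> N = \<one>" using nested_eq_one[OF \<rho>] by blast
  define D where "D = (\<lambda>z. A \<rho> z - z)"
  have DD: "D z = 0" if "D (D z) = 0" for z
  proof -
    have "D z \<bullet> D z = 0"
      using orthogonal_fixed_inner[OF orth, of \<rho> "D z" z] that by (simp add: D_def)
    then show ?thesis by simp
  qed
  have nest: "(\<forall>z. A (nested \<rho> \<omega> k) z = z) \<and> a (nested \<rho> \<omega> k) = 0
      \<and> a \<rho> *\<^sub>R b (nested \<rho> \<omega> k) = 0 \<and> c (nested \<rho> \<omega> k) = (D ^^ k) (c \<omega>)" for k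
  proof (induction k)
    case (Suc k)
    let ?x = "nested \<rho> \<omega> k"
    have [simp]: "A ?x z = z" "a ?x = 0" for z using Suc by auto
    have b0: "a \<rho> *\<^sub>R b ?x = 0" using Suc by simp
    have A1: "A (comm \<rho> ?x) z = z" for z
    proof -
      obtain y where "z = A \<rho> y" using orth[of \<rho>] by (metis \<open>\<rho> \<in> carrier G\<close> orthogonal_transformation_surj surjD)
      then show ?thesis using A_comm[of \<rho> ?x y] by simp
    qed
    have b1: "a \<rho> *\<^sub>R b (comm \<rho> ?x) = 0"
      using b0 by (auto simp: b_comm A1 linear_0[OF linA])
    have "c (comm \<rho> ?x) = D (c ?x)"
      by (simp only: c_comm A1 \<open>\<rho> \<in> carrier G\<close> nested_closed \<open>\<omega> \<in> carrier G\<close> b0 b1 \<open>a ?x = 0\<close>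
          \<open>\<And>z. A ?x z = z\<close>) (simp add: D_def b0 b1)
    then show ?case using Suc A1 b1 by (simp add: a_comm)
  qed (use \<omega> ab in simp)
  have "D (c \<omega>) = 0" if "(D ^^ N) (c \<omega>) = 0" for N
    using that
  proof (induction N)
    case 0 then show ?case by (simp add: D_def linear_0[OF linA])
  next
    case (Suc N)
    show ?case
    proof (cases N)
      case (Suc M)
      then have "(D ^^ N) (c \<omega>) = 0" using Suc.prems DD by simp
      then show ?thesis by (rule Suc.IH)
    qed (use Suc.prems in simp)
  qed
  moreover have "(D ^^ N) (c \<omega>) = 0" using nest[of N] by (simp add: N c_one)
  ultimately show ?thesis by (simp add: D_def)
qed

text \<open>Otherwise let \<open>\<omega>\<close> be the last nontrivial nested commutator. It has
  trivial rotation and \<open>a \<omega> = 0\<close>, so \<open>w = c \<omega>\<close> is nonzero by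
  \<open>separated\<close>. But \<open>w\<close> is fixed by the rotations of \<open>\<psi>\<close>
  and \<open>\<rho>\<close>, hence orthogonal to all summands of its own commutator formula. The
  condition on \<open>a\<close> makes the shear terms vanish when \<open>a \<psi> = 0\<close>, where
  \<open>shear_in_range\<close> says nothing.\<close>

lemma small_commute_aux:
  assumes \<psi>: "small \<psi>" and \<phi>: "small \<phi>" and aa: "a \<psi> = 0 \<Longrightarrow> a \<phi> = 0"
  shows "\<phi> \<otimes> \<psi> = \<psi> \<otimes> \<phi>"
proof -
  have [simp]: "\<psi> \<in> carrier G" "\<phi> \<in> carrier G" using assms by (auto simp: small_def)
  define N where "N = (LEAST N. nested \<psi> \<phi> N = \<one>)"
  have N: "nested \<psi> \<phi> N = \<one>"
    unfolding N_def by (rule LeastI_ex[OF nested_eq_one[OF \<psi> \<phi>]])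
  have min: "nested \<psi> \<phi> k \<noteq> \<one>" if "k < N" for k
    using not_less_Least that unfolding N_def by blast
  consider "N = 0" | "N = 1" | M where "N = Suc (Suc M)"
    by (metis One_nat_def not0_implies_Suc)
  then show ?thesis
  proof cases
    case 1 then show ?thesis using N by simp
  next
    case 2 then show ?thesis using N comm_eq_one[of \<psi> \<phi>] by simp
  next
    case 3
    define \<rho> \<omega> where "\<rho> = nested \<psi> \<phi> M" and "\<omega> = comm \<psi> \<rho>"
    have [simp]: "\<rho> \<in> carrier G" "\<omega> \<in> carrier G" by (simp_all add: \<rho>_def \<omega>_def)
    have \<omega>_nested: "\<omega> = nested \<psi> \<phi> (Suc M)" by (simp add: \<omega>_def \<rho>_def)
    have \<omega>1: "\<omega> \<noteq> \<one>" unfolding \<omega>_nested using min 3 by blast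
    have A\<omega>[simp]: "A \<omega> z = z" for z
      unfolding \<omega>_nested by (rule nested_rotation_trivial[OF \<psi> \<phi> N]) (use 3 in auto)
    have a\<omega>[simp]: "a \<omega> = 0" unfolding \<omega>_def by (simp add: a_comm)
    have \<rho>: "small \<rho>" unfolding \<rho>_def by (rule nested_small[OF \<psi> \<phi>])
    have a\<rho>: "a \<rho> = 0" if "a \<psi> = 0"
      unfolding \<rho>_def using aa[OF that] by (cases M) (simp_all add: a_comm)
    have com: "comm \<psi> \<omega> = \<one>" using N by (simp add: 3 \<omega>_nested)
    define w where "w = c \<omega>"
    have b1: "A \<psi> (b \<omega>) = b \<omega>"
      using b_comm[of \<psi> \<omega>] by (simp add: com b_one A_one)
    have c1: "A \<psi> w - w = a \<psi> *\<^sub>R b \<omega>"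
      using c_comm[of \<psi> \<omega>] by (simp add: com c_one b_one A_one w_def)
    \<comment> \<open>\<open>b \<omega>\<close> is fixed by \<open>A \<psi>\<close>, while
      \<open>a \<psi> *\<^sub>R b \<omega>\<close> lies in the range of \<open>A \<psi> - 1\<close>:
      two parallel vectors that are orthogonal.\<close>
    have "b \<omega> \<bullet> (a \<psi> *\<^sub>R b \<omega>) = 0"
      using orthogonal_fixed_inner[OF orth b1, of w] by (simp add: c1)
    then have ab: "a \<psi> *\<^sub>R b \<omega> = 0" by simp
    then have ab': "a \<rho> *\<^sub>R b \<omega> = 0" using a\<rho> by auto
    have w\<psi>: "A \<psi> w = w" using c1 ab by simp
    have w\<rho>: "A \<rho> w = w"
      unfolding w_def by (rule fixed_if_nested_translation[OF \<rho>]) (use ab' in auto)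
    have w_eq: "w = A \<psi> (c \<rho>) - c \<rho> + (c \<psi> - A \<rho> (c \<psi>)) + a \<rho> *\<^sub>R b \<psi> - a \<psi> *\<^sub>R b \<rho>"
      using c_comm[of \<psi> \<rho>] ab ab' by (simp add: \<omega>_def[symmetric] w_def scaleR_add_left)
    have ortho: "w \<bullet> b g = 0" if "g \<in> carrier G" "a g \<noteq> 0" "A g w = w" for g
      using shear_in_range[OF that(1,2)] orthogonal_fixed_inner[OF orth[OF that(1)] that(3)] by auto
    have adj: "w \<bullet> A \<psi> z = w \<bullet> z" for z
      using orthogonal_fixed_inner[OF orth w\<psi>, of z] by (simp add: inner_diff_right)
    have shear: "w \<bullet> (a \<rho> *\<^sub>R b \<psi> - a \<psi> *\<^sub>R b \<rho>) = 0"
    proof (cases "a \<psi> = 0")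
      case False
      have \<psi>0: "w \<bullet> b \<psi> = 0" using ortho False w\<psi> by simp
      \<comment> \<open>As \<open>a \<rho>\<close> may vanish, \<open>shear_in_range\<close> is
        applied to \<open>\<psi> \<otimes> \<rho>\<close>, or to
        \<open>\<psi> \<otimes> (\<psi> \<otimes> \<rho>)\<close> if \<open>a\<close> vanishes on
        the former; the contribution of \<open>\<psi>\<close> is already known to be orthogonal to
        \<open>w\<close>.\<close>
      have "w \<bullet> b \<rho> = 0"
      proof (cases "a \<psi> + a \<rho> = 0")
        case True
        then have "a (\<psi> \<otimes> (\<psi> \<otimes> \<rho>)) \<noteq> 0" using False by (simp add: a_mult)
        then have "w \<bullet> b (\<psi> \<otimes> (\<psi> \<otimes> \<rho>)) = 0"
          by (intro ortho) (simp_all add: A_mult w\<psi> w\<rho>)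
        then show ?thesis by (simp add: b_mult inner_add_right adj \<psi>0)
      next
        case ne: False
        then have "a (\<psi> \<otimes> \<rho>) \<noteq> 0" by (simp add: a_mult)
        then have "w \<bullet> b (\<psi> \<otimes> \<rho>) = 0"
          by (intro ortho) (simp_all add: A_mult w\<psi> w\<rho>)
        then show ?thesis by (simp add: b_mult inner_add_right adj \<psi>0)
      qed
      with \<psi>0 show ?thesis by (simp add: inner_diff_right)
    qed (use a\<rho> in simp)
    have "w \<bullet> w = w \<bullet> (A \<psi> (c \<rho>) - c \<rho>) - w \<bullet> (A \<rho> (c \<psi>) - c \<psi>)
        + w \<bullet> (a \<rho> *\<^sub>R b \<psi> - a \<psi> *\<^sub>R b \<rho>)"
      by (subst (2) w_eq) (simp add: algebra_simps)
    also have "\<dots> = 0"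
      using orthogonal_fixed_inner[OF orth w\<psi>] orthogonal_fixed_inner[OF orth w\<rho>] shear by simp
    finally have "w = 0" by simp
    then show ?thesis using separated[of \<omega>] \<omega>1 \<delta>_pos by (simp add: w_def)
  qed
qed

text \<open>At most one order of the pair violates the side condition on \<open>a\<close>.\<close>

lemma small_commute:
  assumes "small g" "small h"
  shows "g \<otimes> h = h \<otimes> g"
  using small_commute_aux[OF assms] small_commute_aux[OF assms(2,1)] by metis

section \<open>An abelian subgroup of finite index\<close>

lemma generate_commute:
  assumes S: "S \<subseteq> carrier G" and x: "x \<in> carrier G" and xS: "\<And>s. s \<in> S \<Longrightarrow> x \<otimes> s = s \<otimes> x"
    and y: "y \<in> generate G S"
  shows "x \<otimes> y = y \<otimes> x"
  using y
proof (induction y rule: generate.induct)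
  case (inv s)
  then have s: "s \<in> carrier G" "x \<otimes> s = s \<otimes> x" using S xS by auto
  have "x = s \<otimes> x \<otimes> inv s" using s x by (metis inv_solve_right' m_closed)
  then have "inv s \<otimes> x = inv s \<otimes> (s \<otimes> (x \<otimes> inv s))" using s x by (metis inv_closed m_assoc)
  then show ?case using s x by (simp add: m_assoc[symmetric])
next
  case (eng u v)
  then have "u \<in> carrier G" "v \<in> carrier G" using generate_incl[OF S] by auto
  with eng x show ?case by (metis m_assoc)
qed (use x xS in auto)

theorem virtually_abelian: "virtually_abelian G"
proof -
  define S where "S = Collect small"
  define H where "H = generate G S"
  have S: "S \<subseteq> carrier G" by (auto simp: S_def small_def)
  then have H: "subgroup H G" unfolding H_def by (rule generate_is_subgroup)
  have HG: "H \<subseteq> carrier G" using H by (rule subgroup.subset)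
  have "x \<otimes> y = y \<otimes> x" if "x \<in> H" "y \<in> H" for x y
  proof -
    have "s \<otimes> y = y \<otimes> s" if s: "s \<in> S" for s
      using generate_commute[OF S, of s y] small_commute s \<open>y \<in> H\<close> S by (auto simp: S_def H_def)
    then show ?thesis
      using generate_commute[OF S, of y x] that HG by (auto simp: H_def)
  qed
  then have comm: "comm_group (G\<lparr>carrier := H\<rparr>)"
    using subgroup.subgroup_is_group[OF H group_axioms]
    by (intro group.group_comm_groupI) auto
  define f where "f g = Blinfun (A g)" for g
  have f: "blinfun_apply (f g) = A g" if "g \<in> carrier G" for g
    unfolding f_def by (rule bounded_linear_Blinfun_apply) (simp add: linA linear_conv_bounded_linear[symmetric] that)
  have "bounded (f ` carrier G)"
    unfolding bounded_iff by (auto intro!: exI[of _ 1] norm_blinfun_bound simp: f normA)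
  then have "compact (closure (f ` carrier G))" by (simp add: compact_closure)
  \<comment> \<open>The radius is half the threshold \<open>1/8\<close>: rotations assigned to the
    same centre are less than \<open>1/8\<close> apart, and \<open>A h - A g\<close> equals
    \<open>A (h \<otimes> inv g) - 1\<close> up to the isometry \<open>A g\<close>.\<close>
  then obtain k where k: "finite k" "closure (f ` carrier G) \<subseteq> (\<Union>x\<in>k. ball x (1/16))"
    unfolding compact_eq_totally_bounded by (metis divide_pos_pos zero_less_numeral zero_less_one)
  then have "\<forall>g\<in>carrier G. \<exists>x\<in>k. dist x (f g) < 1/16"
    using closure_subset[of "f ` carrier G"] by (fastforce simp: subset_iff)
  then obtain j where j: "\<And>g. g \<in> carrier G \<Longrightarrow> j g \<in> k \<and> dist (j g) (f g) < 1/16" by metis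
  have coset_eq: "H #> g = H #> h" if g: "g \<in> carrier G" and h: "h \<in> carrier G" and "j g = j h" for g h
  proof -
    have dist: "dist (f h) (f g) < 1/8"
      using j[OF g] j[OF h] dist_triangle2[of "f h" "f g" "j h"] that by (simp add: dist_commute)
    have "norm (A (h \<otimes> inv g) x - x) \<le> norm x / 8" for x
    proof -
      obtain y where y: "x = A g y"
        using orth[OF g] by (metis orthogonal_transformation_surj surjD)
      have "A (inv g) (A g y) = y" using A_mult[of "inv g" g y] g by (simp add: A_one)
      then have "A (h \<otimes> inv g) x - x = blinfun_apply (f h - f g) y"
        using g h by (simp add: y A_mult f blinfun.diff_left)
      then have "norm (A (h \<otimes> inv g) x - x) \<le> norm (f h - f g) * norm y"
        by (simp add: norm_blinfun)
      also have "\<dots> \<le> 1/8 * norm y" using dist by (intro mult_right_mono) (auto simp: dist_norm)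
      finally show ?thesis using g by (simp add: y normA)
    qed
    then have "h \<otimes> inv g \<in> H"
      unfolding H_def using g h by (intro generate.incl) (simp add: S_def small_def)
    moreover have "h = h \<otimes> inv g \<otimes> g" using g h by (simp add: m_assoc)
    ultimately have "h \<in> H #> g" unfolding r_coset_def by blast
    then show ?thesis using g H by (rule repr_independence)
  qed
  have "rcosets H \<subseteq> (\<lambda>x. H #> (SOME g. g \<in> carrier G \<and> j g = x)) ` k"
  proof
    fix X assume "X \<in> rcosets H"
    then obtain g where g: "g \<in> carrier G" "X = H #> g" by (auto simp: RCOSETS_def)
    define h where "h = (SOME h. h \<in> carrier G \<and> j h = j g)"
    have h: "h \<in> carrier G \<and> j h = j g" unfolding h_def by (rule someI[of _ g]) (simp add: g)
    then have "X = H #> h" using coset_eq[of g h] g by simp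
    then show "X \<in> (\<lambda>x. H #> (SOME g. g \<in> carrier G \<and> j g = x)) ` k"
      using j[OF g(1)] by (auto simp: h_def)
  qed
  then have "finite (rcosets H)" using k(1) by (rule finite_subset[OF _ finite_imageI])
  with H comm show ?thesis unfolding virtually_abelian_def by blast
qed

end

text \<open>The group laws of \<open>K\<close> are themselves transported along the surjection; for
  the fundamental group this replaces the usual reparametrisation homotopies.\<close>

lemma virtually_abelian_epi:
  assumes va: "virtually_abelian G" and hom: "h \<in> hom G K"
    and surj: "h ` carrier G = carrier K" and one: "h \<one>\<^bsub>G\<^esub> = \<one>\<^bsub>K\<^esub>"
  shows "virtually_abelian K"
proof -
  from va obtain H where G: "group G" and H: "subgroup H G"
    and comm: "comm_group (G\<lparr>carrier := H\<rparr>)" and fin: "finite (rcosets\<^bsub>G\<^esub> H)"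
    unfolding virtually_abelian_def by blast
  have K: "group K"
    using group.hom_imp_img_group[OF G hom] by (simp add: surj one)
  interpret group_hom G K h
    using G K hom by (simp add: group_hom_def group_hom_axioms_def)
  have sub: "subgroup (h ` H) K" by (rule subgroup_img_is_subgroup[OF H])
  have HG: "H \<subseteq> carrier G" using H by (rule subgroup.subset)
  have "x \<otimes>\<^bsub>K\<^esub> y = y \<otimes>\<^bsub>K\<^esub> x" if xy: "x \<in> h ` H" "y \<in> h ` H" for x y
  proof -
    from xy obtain u v where uv: "u \<in> H" "v \<in> H" "x = h u" "y = h v" by blast
    then have "u \<otimes>\<^bsub>G\<^esub> v = v \<otimes>\<^bsub>G\<^esub> u" using comm_groupE(4)[OF comm, of u v] by simp
    then show ?thesis using uv HG by (metis hom_mult subsetD)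
  qed
  then have comm': "comm_group (K\<lparr>carrier := h ` H\<rparr>)"
    using subgroup.subgroup_is_group[OF sub K] by (intro group.group_comm_groupI) auto
  have "h ` H #>\<^bsub>K\<^esub> h g = h ` (H #>\<^bsub>G\<^esub> g)" if "g \<in> carrier G" for g
    unfolding r_coset_def using HG that by (auto simp: image_iff subset_iff)
  then have "rcosets\<^bsub>K\<^esub> (h ` H) = image h ` (rcosets\<^bsub>G\<^esub> H)"
    unfolding RCOSETS_def surj[symmetric] by auto
  then have "finite (rcosets\<^bsub>K\<^esub> (h ` H))" using fin by simp
  with sub comm' K show ?thesis unfolding virtually_abelian_def by blast
qed

section \<open>Lorentz isometries with spacelike displacements\<close>

text \<open>For a unit vector \<open>i\<close> this is the Lorentzian form that is \<open>1\<close>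
  on \<open>i\<close> and minus the inner product on the orthogonal complement of \<open>i\<close>,
  so Euclidean estimates and form identities can be combined.\<close>

definition minkowski :: "'a::euclidean_space \<Rightarrow> 'a \<Rightarrow> 'a \<Rightarrow> real" where
  "minkowski i x y = 2 * (x \<bullet> i) * (y \<bullet> i) - x \<bullet> y"

lemma minkowski_sym: "minkowski i x y = minkowski i y x"
  by (simp add: minkowski_def inner_commute)

lemma minkowski_add [simp]:
  "minkowski i (x + y) z = minkowski i x z + minkowski i y z"
  "minkowski i z (x + y) = minkowski i z x + minkowski i z y"
  by (simp_all add: minkowski_def algebra_simps)

lemma minkowski_diff [simp]:
  "minkowski i (x - y) z = minkowski i x z - minkowski i y z"
  "minkowski i z (x - y) = minkowski i z x - minkowski i z y"
  by (simp_all add: minkowski_def algebra_simps)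

lemma minkowski_scaleR [simp]:
  "minkowski i (r *\<^sub>R x) z = r * minkowski i x z" "minkowski i z (r *\<^sub>R x) = r * minkowski i z x"
  by (simp_all add: minkowski_def algebra_simps)

lemma minkowski_zero [simp]: "minkowski i 0 x = 0" "minkowski i x 0 = 0"
  by (simp_all add: minkowski_def)

lemma tendsto_minkowski [tendsto_intros]:
  "\<lbrakk>(f \<longlongrightarrow> x) F; (g \<longlongrightarrow> y) F\<rbrakk> \<Longrightarrow> ((\<lambda>t. minkowski i (f t) (g t)) \<longlongrightarrow> minkowski i x y) F"
  unfolding minkowski_def by (intro tendsto_intros)

lemma real_affine_bounded_above:
  fixes \<alpha> \<beta> :: real
  assumes "\<And>t. \<alpha> * t + \<beta> \<le> 0"
  shows "\<alpha> = 0"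
proof (rule ccontr)
  assume "\<alpha> \<noteq> 0"
  then show False using assms[of "(1 - \<beta>) / \<alpha>"] by simp
qed

lemma real_quadratic_bounded_above:
  fixes \<alpha> \<beta> \<gamma> :: real
  assumes "\<And>t. \<alpha> * t\<^sup>2 + \<beta> * t + \<gamma> \<le> 0"
  shows "\<alpha> \<le> 0"
proof -
  have "\<alpha> * t\<^sup>2 + \<gamma> \<le> 0" for t using assms[of t] assms[of "- t"] by simp
  moreover have "\<alpha> * (sqrt ((1 + \<bar>\<gamma>\<bar>) / \<alpha>))\<^sup>2 = 1 + \<bar>\<gamma>\<bar>" if "\<alpha> > 0"
    using that by simp
  ultimately show ?thesis by (smt (verit))
qed

text \<open>\<open>\<tau> g\<close> is the displacement of the origin. \<open>spacelike\<close>
  concerns all points, whereas the uniform gap to the cone is recorded at the origin only.\<close>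

locale spacelike_displacements = group G for G (structure) +
  fixes \<Lambda> :: "'g \<Rightarrow> 'a::euclidean_space \<Rightarrow> 'a" and \<tau> :: "'g \<Rightarrow> 'a" and i :: 'a and \<delta> :: real
  assumes norm_i: "norm i = 1"
    and lin: "g \<in> carrier G \<Longrightarrow> linear (\<Lambda> g)"
    and \<Lambda>_mult: "\<lbrakk>g \<in> carrier G; h \<in> carrier G\<rbrakk> \<Longrightarrow> \<Lambda> (g \<otimes> h) x = \<Lambda> g (\<Lambda> h x)"
    and \<tau>_mult: "\<lbrakk>g \<in> carrier G; h \<in> carrier G\<rbrakk> \<Longrightarrow> \<tau> (g \<otimes> h) = \<Lambda> g (\<tau> h) + \<tau> g"
    and isometry: "g \<in> carrier G \<Longrightarrow> minkowski i (\<Lambda> g x) (\<Lambda> g y) = minkowski i x y"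
    and spacelike: "\<lbrakk>g \<in> carrier G; g \<noteq> \<one>\<rbrakk> \<Longrightarrow>
      minkowski i (\<Lambda> g v + \<tau> g - v) (\<Lambda> g v + \<tau> g - v) < 0"
    and \<delta>_pos: "\<delta> > 0"
    and separated: "\<lbrakk>g \<in> carrier G; g \<noteq> \<one>; minkowski i z z \<ge> 0\<rbrakk> \<Longrightarrow> \<delta> \<le> norm (\<tau> g - z)"
begin

abbreviation M :: "'a \<Rightarrow> 'a \<Rightarrow> real" where "M \<equiv> minkowski i"

lemma ii [simp]: "i \<bullet> i = 1" using norm_i by (simp add: norm_eq_1)

lemma M_i [simp]: "M x i = x \<bullet> i" "M i x = x \<bullet> i"
  by (simp_all add: minkowski_def inner_commute)

lemma nondegenerate: "(\<And>v. M x v = 0) \<Longrightarrow> x = 0"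
proof -
  assume *: "\<And>v. M x v = 0"
  have "x \<bullet> x = 0" using *[of x] *[of i] by (simp add: minkowski_def)
  then show ?thesis by simp
qed

text \<open>Subtracting the multiple of \<open>x\<close> with the same \<open>i\<close>-component
  leaves a vector on which the form is minus the Euclidean square, while orthogonality gives it the
  value \<open>M w w + r\<^sup>2 * M x x\<close>, a sum of nonnegative terms.\<close>

lemma orthogonal_to_timelike:
  assumes "M x x > 0" "M x w = 0" "M w w \<ge> 0"
  shows "w = 0"
proof -
  have xi: "x \<bullet> i \<noteq> 0" using assms(1) inner_ge_zero[of x] by (auto simp: minkowski_def simp del: inner_ge_zero)
  define r where "r = (w \<bullet> i) / (x \<bullet> i)"
  define y where "y = w - r *\<^sub>R x"
  have "y \<bullet> i = 0" using xi by (simp add: y_def r_def inner_diff_left)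
  then have "M y y = - (y \<bullet> y)" by (simp add: minkowski_def)
  moreover have "M y y = M w w + r\<^sup>2 * M x x"
    using assms(2) by (simp add: y_def minkowski_sym[of i w x] power2_eq_square)
  ultimately have sum: "y \<bullet> y + M w w + r\<^sup>2 * M x x = 0" by simp
  moreover have "r\<^sup>2 * M x x \<ge> 0" using assms(1) by simp
  ultimately have "y \<bullet> y = 0" "r\<^sup>2 * M x x = 0" using assms(3) inner_ge_zero[of y] by linarith+
  then show ?thesis using assms(1) by (simp add: y_def)
qed

lemma null_orthogonal_parallel:
  assumes "M x x = 0" "M y y = 0" "M x y = 0" "x \<noteq> 0"
  shows "\<exists>r. y = r *\<^sub>R x"
proof -
  have xi: "x \<bullet> i \<noteq> 0" using assms(1,4) by (auto simp: minkowski_def)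
  define w where "w = y - ((y \<bullet> i) / (x \<bullet> i)) *\<^sub>R x"
  have "w \<bullet> i = 0" using xi by (simp add: w_def inner_diff_left)
  moreover have "M w w = 0" using assms by (simp add: w_def minkowski_sym[of i y x])
  ultimately have "w = 0" by (simp add: minkowski_def)
  then show ?thesis by (auto simp: w_def)
qed

lemma \<Lambda>_one [simp]: "\<Lambda> \<one> x = x"
proof -
  have "M x v = M (\<Lambda> \<one> x) v" for v
    using isometry[of \<one> x v] isometry[of \<one> "\<Lambda> \<one> x" v] \<Lambda>_mult[of \<one> \<one> x] by simp
  then show ?thesis using nondegenerate[of "x - \<Lambda> \<one> x"] by simp
qed

text \<open>Displacements are affine in \<open>v\<close>, so the leading coefficient of their square along a line is
  nonpositive.\<close>

lemma linear_displacement_nonpos: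
  assumes g: "g \<in> carrier G"
  shows "M (\<Lambda> g v - v) (\<Lambda> g v - v) \<le> 0"
proof (cases "g = \<one>")
  case False
  show ?thesis
  proof (rule real_quadratic_bounded_above)
    fix t :: real
    have "\<Lambda> g (t *\<^sub>R v) + \<tau> g - t *\<^sub>R v = t *\<^sub>R (\<Lambda> g v - v) + \<tau> g"
      by (simp add: linear_scale[OF lin[OF g]] algebra_simps)
    then have "M (t *\<^sub>R (\<Lambda> g v - v) + \<tau> g) (t *\<^sub>R (\<Lambda> g v - v) + \<tau> g) \<le> 0"
      using spacelike[OF g False, of "t *\<^sub>R v"] by (simp only: less_imp_le)
    then show "M (\<Lambda> g v - v) (\<Lambda> g v - v) * t\<^sup>2 + (2 * M (\<Lambda> g v - v) (\<tau> g)) * t + M (\<tau> g) (\<tau> g) \<le> 0"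
      by (simp only: minkowski_add minkowski_scaleR minkowski_sym[of i "\<tau> g" "\<Lambda> g v - v"])
        (simp only: algebra_simps power2_eq_square)
  qed
qed simp

text \<open>Since \<open>\<Lambda> g\<close> is an isometry, the quadratic inequality for
  \<open>\<Lambda> g v - v\<close> becomes linear in \<open>\<Lambda> g\<close>, and so survives
  normalisation and limits.\<close>

lemma isometry_dominates: "g \<in> carrier G \<Longrightarrow> M v v \<le> M (\<Lambda> g v) v"
  using linear_displacement_nonpos[of g v] by (simp add: isometry minkowski_sym[of i v "\<Lambda> g v"])

text \<open>This excludes boosts. Along the null line \<open>s *\<^sub>R \<xi> + m\<close> the
  square of the linear displacement is affine in \<open>s\<close>, so its slope
  \<open>2 * (\<mu> - 1) * M \<xi> d\<close> vanishes; and if \<open>M \<xi> d = 0\<close>,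
  invariance of \<open>M \<xi> m \<noteq> 0\<close> again gives \<open>\<mu> = 1\<close>.\<close>

lemma nullvector_eigenvalue_one:
  assumes g: "g \<in> carrier G" and \<xi>: "\<xi> \<noteq> 0" "M \<xi> \<xi> = 0" and \<mu>: "\<Lambda> g \<xi> = \<mu> *\<^sub>R \<xi>"
  shows "\<Lambda> g \<xi> = \<xi>"
proof -
  obtain m where m: "M \<xi> m \<noteq> 0" using nondegenerate \<xi>(1) by blast
  define d where "d = \<Lambda> g m - m"
  have "2 * (\<mu> - 1) * M \<xi> d = 0"
  proof (rule real_affine_bounded_above)
    fix s :: real
    have "\<Lambda> g (s *\<^sub>R \<xi> + m) - (s *\<^sub>R \<xi> + m) = (s * (\<mu> - 1)) *\<^sub>R \<xi> + d"
      by (simp add: d_def linear_add[OF lin[OF g]] linear_scale[OF lin[OF g]] \<mu> algebra_simps)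
    then have "M ((s * (\<mu> - 1)) *\<^sub>R \<xi> + d) ((s * (\<mu> - 1)) *\<^sub>R \<xi> + d) \<le> 0"
      using linear_displacement_nonpos[OF g, of "s *\<^sub>R \<xi> + m"] by simp
    then show "2 * (\<mu> - 1) * M \<xi> d * s + M d d \<le> 0"
      by (simp add: \<xi>(2) minkowski_sym[of i d \<xi>] algebra_simps)
  qed
  then consider "\<mu> = 1" | "M \<xi> d = 0" by auto
  then have "\<mu> = 1"
  proof cases
    case 2
    then have "M \<xi> (\<Lambda> g m) = M \<xi> m" by (simp add: d_def)
    moreover have "\<mu> * M \<xi> (\<Lambda> g m) = M \<xi> m" using isometry[OF g, of \<xi> m] by (simp add: \<mu>)
    ultimately show ?thesis using m by simp
  qed
  then show ?thesis by (simp add: \<mu>)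
qed

abbreviation L :: "'g \<Rightarrow> 'a \<Rightarrow>\<^sub>L 'a" where "L g \<equiv> Blinfun (\<Lambda> g)"

lemma apply_L: "g \<in> carrier G \<Longrightarrow> blinfun_apply (L g) = \<Lambda> g"
  by (rule bounded_linear_Blinfun_apply) (simp add: lin linear_conv_bounded_linear[symmetric])

text \<open>A limit \<open>T\<close> of the normalised linear parts has totally isotropic, hence one-dimensional, image,
  and \<open>isometry_dominates\<close> passes to the limit as \<open>0 \<le> M (\<Lambda> h (T v)) v\<close>.\<close>

lemma unbounded_imp_fixed_null:
  assumes unbounded: "\<not> bounded (L ` carrier G)"
  shows "\<exists>\<xi>. \<xi> \<noteq> 0 \<and> M \<xi> \<xi> = 0 \<and> (\<forall>g\<in>carrier G. \<Lambda> g \<xi> = \<xi>)"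
proof -
  have "\<exists>g\<in>carrier G. norm (L g) > real (Suc k)" for k
  proof (rule ccontr)
    assume "\<not> ?thesis"
    then have "\<forall>x\<in>L ` carrier G. norm x \<le> real (Suc k)" by (auto simp: not_less)
    then show False using unbounded unfolding bounded_iff by blast
  qed
  then obtain s where s: "\<And>k. s k \<in> carrier G" "\<And>k. norm (L (s k)) > real (Suc k)" by metis
  define N where "N k = norm (L (s k))" for k
  have N: "N k > real (Suc k)" "N k > 0" for k
    using s(2)[of k] unfolding N_def by (simp, linarith)
  define T' where "T' k = (1 / N k) *\<^sub>R L (s k)" for k
  have T'_apply: "blinfun_apply (T' k) x = (1 / N k) *\<^sub>R \<Lambda> (s k) x" for k x
    by (simp add: T'_def apply_L s scaleR_blinfun.rep_eq)
  have "T' k \<in> sphere 0 1" for k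
    using N(2)[of k] by (simp add: T'_def N_def)
  moreover have compact: "compact (sphere (0 :: 'a \<Rightarrow>\<^sub>L 'a) 1)"
    unfolding compact_eq_bounded_closed
    by (auto simp: bounded_iff sphere_def intro!: exI[of _ 1] closed_Collect_eq continuous_intros)
  ultimately obtain T r where T: "T \<in> sphere 0 1" "strict_mono r" "(T' \<circ> r) \<longlonglongrightarrow> T"
    using compact unfolding compact_def by blast
  have lim: "(\<lambda>k. blinfun_apply (T' (r k)) x) \<longlonglongrightarrow> blinfun_apply T x" for x
    using T(3) by (intro tendsto_intros) (simp add: comp_def)
  have inv_N: "(\<lambda>k. 1 / N (r k)) \<longlonglongrightarrow> 0"
  proof (rule tendsto_sandwich[OF _ _ tendsto_const])
    have "1 / N (r k) \<le> 1 / real (Suc k)" for k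
      using N[of "r k"] seq_suble[OF T(2), of k] by (simp add: field_simps)
    then show "\<forall>\<^sub>F k in sequentially. 1 / N (r k) \<le> 1 / real (Suc k)" by simp
    show "(\<lambda>k. 1 / real (Suc k)) \<longlonglongrightarrow> 0" using LIMSEQ_inverse_real_of_nat by (simp add: inverse_eq_divide)
    show "\<forall>\<^sub>F k in sequentially. 0 \<le> 1 / N (r k)" using N(2) by (simp add: less_imp_le)
  qed
  have isotropic: "M (blinfun_apply T x) (blinfun_apply T y) = 0" for x y
  proof (rule LIMSEQ_unique)
    show "(\<lambda>k. M (blinfun_apply (T' (r k)) x) (blinfun_apply (T' (r k)) y)) \<longlonglongrightarrow>
        M (blinfun_apply T x) (blinfun_apply T y)"
      by (intro tendsto_intros lim)
    have "(\<lambda>k. (1 / N (r k)) * (1 / N (r k)) * M x y) \<longlonglongrightarrow> 0 * 0 * M x y"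
      by (intro tendsto_intros inv_N)
    then show "(\<lambda>k. M (blinfun_apply (T' (r k)) x) (blinfun_apply (T' (r k)) y)) \<longlonglongrightarrow> 0"
      by (simp add: T'_apply isometry s)
  qed
  have pos: "0 \<le> M (\<Lambda> h (blinfun_apply T v)) v" if h: "h \<in> carrier G" for h v
  proof (rule LIMSEQ_le)
    have "(\<lambda>k. blinfun_apply (L h) (blinfun_apply (T' (r k)) v)) \<longlonglongrightarrow> blinfun_apply (L h) (blinfun_apply T v)"
      by (intro tendsto_intros lim)
    then show "(\<lambda>k. M (\<Lambda> h (blinfun_apply (T' (r k)) v)) v) \<longlonglongrightarrow> M (\<Lambda> h (blinfun_apply T v)) v"
      by (intro tendsto_intros) (simp add: apply_L h)
    have "(\<lambda>k. (1 / N (r k)) * M v v) \<longlonglongrightarrow> 0 * M v v"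
      by (intro tendsto_intros inv_N)
    then show "(\<lambda>k. (1 / N (r k)) * M v v) \<longlonglongrightarrow> 0" by simp
    have "(1 / N (r k)) * M v v \<le> M (\<Lambda> h (blinfun_apply (T' (r k)) v)) v" for k
    proof -
      have "M v v \<le> M (\<Lambda> (h \<otimes> s (r k)) v) v" by (rule isometry_dominates) (simp add: h s)
      then show ?thesis
        using N(2)[of "r k"] by (simp add: T'_apply linear_scale[OF lin[OF h]] \<Lambda>_mult h s divide_right_mono)
    qed
    then show "\<exists>K. \<forall>k\<ge>K. (1 / N (r k)) * M v v \<le> M (\<Lambda> h (blinfun_apply (T' (r k)) v)) v" by blast
  qed
  obtain x where x: "blinfun_apply T x \<noteq> 0"
  proof -
    have "T \<noteq> 0" using T(1) by auto
    then show ?thesis using that by (metis blinfun_eqI zero_blinfun.rep_eq)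
  qed
  define \<xi> where "\<xi> = blinfun_apply T x"
  have \<xi>: "\<xi> \<noteq> 0" "M \<xi> \<xi> = 0" using x isotropic by (simp_all add: \<xi>_def)
  have "\<exists>\<phi>. blinfun_apply T v = \<phi> *\<^sub>R \<xi>" for v
    using null_orthogonal_parallel[of \<xi> "blinfun_apply T v"] \<xi> isotropic by (simp add: \<xi>_def)
  then obtain \<phi> where \<phi>: "\<And>v. blinfun_apply T v = \<phi> v *\<^sub>R \<xi>" by metis
  \<comment> \<open>For \<open>w\<close> in the kernel of \<open>T\<close>, \<open>pos\<close> at
    \<open>x + t *\<^sub>R w\<close> is a nonnegative affine function of \<open>t\<close>, so its
    slope vanishes. Thus \<open>M (\<Lambda> h \<xi>)\<close> is a multiple of \<open>\<phi>\<close>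
    for every \<open>h\<close>, and comparison with \<open>h = \<one>\<close> makes
    \<open>\<xi>\<close> an eigenvector.\<close>
  have proportional: "M (\<Lambda> h \<xi>) v = \<phi> v * M (\<Lambda> h \<xi>) x" if h: "h \<in> carrier G" for h v
  proof -
    define w where "w = v - \<phi> v *\<^sub>R x"
    have w: "blinfun_apply T w = 0" by (simp add: w_def blinfun.diff_right blinfun.scaleR_right \<phi>[of v] \<xi>_def)
    have "- M (\<Lambda> h \<xi>) w = 0"
    proof (rule real_affine_bounded_above)
      fix t :: real
      have "blinfun_apply T (x + t *\<^sub>R w) = \<xi>"
        by (simp add: blinfun.add_right blinfun.scaleR_right w \<xi>_def)
      then show "- M (\<Lambda> h \<xi>) w * t + - M (\<Lambda> h \<xi>) x \<le> 0"
        using pos[OF h, of "x + t *\<^sub>R w"] by (simp add: mult.commute)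
    qed
    then show ?thesis by (simp add: w_def)
  qed
  have \<xi>x: "M \<xi> x \<noteq> 0"
  proof
    assume "M \<xi> x = 0"
    then have "M \<xi> v = 0" for v using proportional[OF one_closed, of v] by simp
    then show False using nondegenerate \<xi>(1) by blast
  qed
  have "\<Lambda> h \<xi> = \<xi>" if h: "h \<in> carrier G" for h
  proof -
    define \<mu> where "\<mu> = M (\<Lambda> h \<xi>) x / M \<xi> x"
    have "M (\<Lambda> h \<xi> - \<mu> *\<^sub>R \<xi>) v = 0" for v
      using proportional[OF h, of v] proportional[OF one_closed, of v] \<xi>x by (simp add: \<mu>_def)
    then have "\<Lambda> h \<xi> = \<mu> *\<^sub>R \<xi>" using nondegenerate[of "\<Lambda> h \<xi> - \<mu> *\<^sub>R \<xi>"] by simp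
    then show ?thesis by (rule nullvector_eigenvalue_one[OF h \<xi>])
  qed
  with \<xi> show ?thesis by blast
qed

text \<open>This is the cone given by \<open>M y y \<ge> 0\<close> and
  \<open>y \<bullet> i \<ge> 0\<close>, written so that convexity follows from the triangle
  inequality.\<close>

definition future :: "'a set" where
  "future = {y. norm y \<le> sqrt 2 * (y \<bullet> i)}"

lemma convex_future: "convex future"
proof (rule convexI)
  fix x y :: 'a and u v :: real
  assume *: "x \<in> future" "y \<in> future" "0 \<le> u" "0 \<le> v" "u + v = 1"
  have "norm (u *\<^sub>R x + v *\<^sub>R y) \<le> u * norm x + v * norm y"
    using *(3,4) norm_triangle_ineq[of "u *\<^sub>R x" "v *\<^sub>R y"] by simp
  also have "\<dots> \<le> u * (sqrt 2 * (x \<bullet> i)) + v * (sqrt 2 * (y \<bullet> i))"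
    using * by (intro add_mono mult_left_mono) (auto simp: future_def)
  finally show "u *\<^sub>R x + v *\<^sub>R y \<in> future" by (simp add: future_def algebra_simps)
qed

lemma closed_future: "closed future"
  unfolding future_def by (intro closed_Collect_le continuous_intros)

lemma future_inner_nonneg:
  assumes "x \<in> future" "y \<in> future"
  shows "M x y \<ge> 0" "x \<bullet> i \<ge> 0"
proof -
  have *: "0 \<le> sqrt 2 * (x \<bullet> i)" "norm x \<le> sqrt 2 * (x \<bullet> i)" "norm y \<le> sqrt 2 * (y \<bullet> i)"
    using assms norm_ge_zero[of x] unfolding future_def by (auto intro: order_trans[OF norm_ge_zero])
  then show "x \<bullet> i \<ge> 0" by (simp add: zero_le_mult_iff)
  have "x \<bullet> y \<le> norm x * norm y" by (rule norm_cauchy_schwarz)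
  also have "\<dots> \<le> (sqrt 2 * (x \<bullet> i)) * (sqrt 2 * (y \<bullet> i))"
    using * by (intro mult_mono) auto
  also have "\<dots> = (sqrt 2 * sqrt 2) * (x \<bullet> i) * (y \<bullet> i)" by (simp only: ac_simps)
  also have "\<dots> = 2 * (x \<bullet> i) * (y \<bullet> i)" by simp
  finally show "M x y \<ge> 0" by (simp add: minkowski_def)
qed

text \<open>The vector of maximal Lorentzian length in the closed convex hull of an orbit on the
  hyperboloid is unique by the reversed Cauchy-Schwarz inequality, hence fixed.\<close>

lemma bounded_imp_fixed_timelike:
  assumes bounded: "bounded (L ` carrier G)"
  shows "\<exists>u. M u u = 1 \<and> u \<bullet> i \<ge> 0 \<and> (\<forall>g\<in>carrier G. \<Lambda> g u = u)"
proof -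
  define O' where "O' = (\<lambda>g. \<Lambda> g i) ` carrier G"
  define K where "K = closure (convex hull O')"
  obtain B where B: "\<And>g. g \<in> carrier G \<Longrightarrow> norm (L g) \<le> B"
    using bounded unfolding bounded_iff by auto
  have "norm (\<Lambda> g i) \<le> B" if "g \<in> carrier G" for g
    using norm_blinfun[of "L g" i] B[OF that] by (simp add: apply_L that norm_i)
  then have "bounded O'" unfolding O'_def bounded_iff by auto
  then have K: "compact K" unfolding K_def by (simp add: bounded_convex_hull compact_closure)
  have convK: "convex K" unfolding K_def by (intro convex_closure convex_convex_hull)
  have "O' \<subseteq> future"
  proof
    fix y assume "y \<in> O'"
    then obtain g where g: "g \<in> carrier G" "y = \<Lambda> g i" by (auto simp: O'_def)
    \<comment> \<open>Domination at \<open>v = i\<close> keeps the orbit on the sheet of the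
      hyperboloid through \<open>i\<close>.\<close>
    have 1: "y \<bullet> i \<ge> 1" using isometry_dominates[OF g(1), of i] g by simp
    have "M y y = 1" using g isometry[of g i i] by simp
    then have "(norm y)\<^sup>2 \<le> (sqrt 2 * (y \<bullet> i))\<^sup>2"
      by (simp add: minkowski_def power2_norm_eq_inner power_mult_distrib power2_eq_square[of "y \<bullet> i"])
    then show "y \<in> future" unfolding future_def using 1 by (auto intro: power2_le_imp_le)
  qed
  then have K_future: "K \<subseteq> future"
    unfolding K_def by (intro closure_minimal hull_minimal convex_future closed_future)
  have invariant: "\<Lambda> g ` K \<subseteq> K" if g: "g \<in> carrier G" for g
  proof -
    have "\<Lambda> g ` (convex hull O') = convex hull (\<Lambda> g ` O')"
      by (rule convex_hull_linear_image[OF lin[OF g]])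
    also have "\<Lambda> g ` O' \<subseteq> O'"
      using g by (auto simp: O'_def \<Lambda>_mult[symmetric])
    then have "convex hull (\<Lambda> g ` O') \<subseteq> convex hull O'" by (rule hull_mono)
    finally have "\<Lambda> g ` (convex hull O') \<subseteq> K" unfolding K_def using closure_subset by blast
    then show ?thesis
      unfolding K_def using lin[OF g]
      by (intro image_closure_subset) (auto simp: linear_continuous_on linear_conv_bounded_linear[symmetric])
  qed
  have iK: "i \<in> K"
  proof -
    have "i \<in> O'" unfolding O'_def by (rule image_eqI[of _ _ \<one>]) simp_all
    then show ?thesis unfolding K_def by (meson closure_subset hull_inc subsetD)
  qed
  have "continuous_on K (\<lambda>y. M y y)" unfolding minkowski_def by (intro continuous_intros)
  then obtain u where u: "u \<in> K" "\<And>y. y \<in> K \<Longrightarrow> M y y \<le> M u u"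
    using continuous_attains_sup[OF K, of "\<lambda>y. M y y"] iK by auto
  have pos: "M u u \<ge> 1" using u(2)[OF iK] by simp
  have fixed: "\<Lambda> g u = u" if g: "g \<in> carrier G" for g
  proof -
    define y where "y = \<Lambda> g u"
    have y: "y \<in> K" "M y y = M u u" using invariant[OF g] u(1) isometry[OF g] by (auto simp: y_def)
    have "(1/2) *\<^sub>R y + (1/2) *\<^sub>R u \<in> K" by (rule convexD[OF convK y(1) u(1)]) auto
    from u(2)[OF this] have "(M u u / 2 + M y u / 2) / 2 + (M y u / 2 + M u u / 2) / 2 \<le> M u u"
      by (simp add: y(2) minkowski_sym[of i u y])
    then have le: "M y u \<le> M u u" by (simp add: field_simps)
    have ge: "M y u \<ge> 0" using future_inner_nonneg(1) K_future y(1) u(1) by blast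
    \<comment> \<open>Equal lengths make \<open>y + u\<close> and \<open>y - u\<close> orthogonal;
      the first is timelike, and \<open>le\<close> makes the second nonspacelike.\<close>
    have "y - u = 0"
    proof (rule orthogonal_to_timelike)
      show "M (y + u) (y + u) > 0" using ge pos by (simp add: y(2) minkowski_sym[of i u y])
    qed (use le in \<open>simp_all add: y(2) minkowski_sym[of i u y]\<close>)
    then show ?thesis by (simp add: y_def)
  qed
  define e where "e = (1 / sqrt (M u u)) *\<^sub>R u"
  have "M e e = 1" using pos by (simp add: e_def real_div_sqrt flip: power2_eq_square)
  moreover have "e \<bullet> i \<ge> 0" using future_inner_nonneg(2)[of u u] K_future u(1) pos by (auto simp: e_def)
  moreover have "\<Lambda> g e = e" if "g \<in> carrier G" for g
    using that by (simp add: e_def linear_scale[OF lin] fixed)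
  ultimately show ?thesis by blast
qed

text \<open>A reflection moves the fixed timelike vector to \<open>i\<close>; then the linear parts are Euclidean
  isometries.\<close>

lemma virtually_abelian_if_bounded:
  assumes "bounded (L ` carrier G)"
  shows "virtually_abelian G"
proof -
  obtain e where e: "M e e = 1" "e \<bullet> i \<ge> 0" "\<And>g. g \<in> carrier G \<Longrightarrow> \<Lambda> g e = e"
    using bounded_imp_fixed_timelike[OF assms] by auto
  define w where "w = e - i"
  \<comment> \<open>If \<open>e = i\<close>, then \<open>w = 0\<close> and division by zero turns
    the reflection into the identity; in all other cases \<open>w\<close> is spacelike, as shown
    below.\<close>
  define R where "R x = x - (2 * M x w / M w w) *\<^sub>R w" for x
  have M_R: "M (R x) (R y) = M x y" for x y
  proof (cases "M w w = 0")
    case False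
    define r s where "r = 2 * M x w / M w w" and "s = 2 * M y w / M w w"
    have "s * (r * M w w) = s * (2 * M x w)" "r * (s * M w w) = r * (2 * M y w)"
      using False by (simp_all add: r_def s_def)
    moreover have "M (R x) (R y) = M x y - s * M x w - r * M y w + r * (s * M w w)"
      unfolding R_def r_def[symmetric] s_def[symmetric]
      by (simp add: minkowski_sym[of i w y] right_diff_distrib)
    ultimately show ?thesis by (simp only: ac_simps)
  qed (simp add: R_def)
  have R_R: "R (R x) = x" for x
  proof (cases "M w w = 0")
    case False
    then have "M (R x) w = - M x w" by (simp add: R_def)
    then show ?thesis by (simp add: R_def[of "R x"]) (simp add: R_def)
  qed (simp add: R_def)
  have linR: "linear R"
    by (rule linearI) (simp_all add: R_def scaleR_left_distrib scaleR_right_diff_distrib add_divide_distrib distrib_left)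
  have "w = 0 \<or> M w w < 0"
  proof (rule disjCI)
    assume "\<not> M w w < 0"
    show "w = 0"
    proof (rule orthogonal_to_timelike)
      show "M (e + i) (e + i) > 0" "M (e + i) w = 0" using e(1,2) by (simp_all add: w_def)
    qed (use \<open>\<not> M w w < 0\<close> in simp)
  qed
  moreover have "2 * M e w = M w w" using e(1) by (simp add: w_def)
  ultimately have Re: "R e = i" by (auto simp: R_def w_def)
  then have Ri: "R i = e" using R_R[of e] by simp
  define A where "A g x = R (\<Lambda> g (R x))" for g x
  obtain B where B: "B > 0" "\<And>x. norm (R x) \<le> B * norm x"
    using linear_bounded_pos[OF linR] by blast
  have orth: "orthogonal_transformation (A g)" if g: "g \<in> carrier G" for g
    unfolding orthogonal_transformation_def
  proof (intro conjI allI)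
    have "A g = R \<circ> (\<Lambda> g \<circ> R)" by (auto simp: A_def)
    then show "linear (A g)" using linR lin[OF g] by (simp add: linear_compose)
    have M_A: "M (A g x) (A g y) = M x y" for x y by (simp add: A_def M_R isometry g)
    have "A g i = i" using g by (simp add: A_def Ri e(3) Re)
    then have "A g x \<bullet> i = x \<bullet> i" for x using M_A[of x i] by simp
    then show "A g x \<bullet> A g y = x \<bullet> y" for x y using M_A[of x y] by (simp add: minkowski_def)
  qed
  \<comment> \<open>A Euclidean action has neither \<open>a\<close> nor \<open>b\<close>.
    \<open>R\<close> preserves the form but distorts the norm by a factor of up to \<open>B\<close>,
    whence \<open>\<delta> / B\<close>.\<close>
  interpret horospherical_action G A "\<lambda>_. 0" "\<lambda>_. 0" "\<lambda>g. R (\<tau> g)" "\<delta> / B"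
  proof unfold_locales
    fix g assume g: "g \<in> carrier G" "g \<noteq> \<one>"
    have "\<delta> \<le> norm (R (R (\<tau> g)))" using separated[OF g, of 0] by (simp add: R_R)
    then show "\<delta> / B \<le> norm (R (\<tau> g))"
      using order_trans[OF _ B(2)[of "R (\<tau> g)"]] B(1) by (simp add: field_simps)
  qed (use \<delta>_pos B(1) in \<open>simp_all add: orth A_def R_R \<Lambda>_mult \<tau>_mult linear_add[OF linR] linear_0[OF linR]
      linear_0[OF lin]\<close>)
  show ?thesis by (rule virtually_abelian)
qed

text \<open>Up to scaling, every null vector has the form \<open>\<xi> = i + k\<close>. In the splitting \<open>x = p \<xi> + q m + P x\<close>
  the form is \<open>2 p q - \<bar>P x\<bar>\<^sup>2\<close>.\<close>

context
  fixes k :: 'a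
  assumes k_i [simp]: "k \<bullet> i = 0" and k_k [simp]: "k \<bullet> k = 1"
    and fixed': "\<And>g. g \<in> carrier G \<Longrightarrow> \<Lambda> g (i + k) = i + k"
begin

definition \<xi> :: 'a where "\<xi> = i + k"
definition m :: 'a where "m = (1/2) *\<^sub>R (i - k)"
definition P :: "'a \<Rightarrow> 'a" where "P x = x - (x \<bullet> i) *\<^sub>R i - (x \<bullet> k) *\<^sub>R k"
definition q :: "'a \<Rightarrow> real" where "q = M \<xi>"
text \<open>The Euclidean factor is the range of \<open>P\<close>, which is not a type; extension by
  the identity on the span of \<open>i\<close> and \<open>k\<close> makes \<open>A g\<close> an
  orthogonal map of the whole space.\<close>

definition A :: "'g \<Rightarrow> 'a \<Rightarrow> 'a" where "A g x = P (\<Lambda> g (P x)) + (x - P x)"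

lemma i_k [simp]: "i \<bullet> k = 0" using k_i by (simp only: inner_commute)

lemma \<xi>_i [simp]: "\<xi> \<bullet> i = 1" by (simp add: \<xi>_def inner_add_left)

lemma null: "M \<xi> \<xi> = 0" by (simp add: \<xi>_def minkowski_def inner_add)

lemma fixed: "g \<in> carrier G \<Longrightarrow> \<Lambda> g \<xi> = \<xi>" by (simp add: \<xi>_def fixed')

lemma q_eq: "q x = x \<bullet> i - x \<bullet> k"
  by (simp add: q_def minkowski_def \<xi>_def inner_add_left inner_add_right inner_commute)

lemma P_inner [simp]: "P x \<bullet> i = 0" "P x \<bullet> k = 0"
  by (simp_all add: P_def inner_diff_left)

lemma P_simps [simp]: "P i = 0" "P k = 0" "P \<xi> = 0" "P m = 0" "P (P x) = P x" "P 0 = 0"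
  "P (x + y) = P x + P y" "P (x - y) = P x - P y" "P (r *\<^sub>R x) = r *\<^sub>R P x"
  by (simp_all add: P_def \<xi>_def m_def algebra_simps)

lemma q_simps [simp]: "q (P x) = 0" "q m = 1" "q \<xi> = 0"
  by (simp_all add: q_eq, simp_all add: m_def \<xi>_def algebra_simps)

lemma q_linear [simp]: "q (x + y) = q x + q y" "q (x - y) = q x - q y"
  by (simp_all add: q_def)

lemma q_\<Lambda> [simp]: "g \<in> carrier G \<Longrightarrow> q (\<Lambda> g x) = q x"
  using isometry[of g \<xi> x] by (simp add: q_def fixed)

lemma decompose: "x = ((x \<bullet> i + x \<bullet> k) / 2) *\<^sub>R \<xi> + q x *\<^sub>R m + P x"
proof -
  define s t where "s = (x \<bullet> i + x \<bullet> k) / 2" and "t = (x \<bullet> i - x \<bullet> k) / 2"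
  have "s *\<^sub>R \<xi> + q x *\<^sub>R m = (s + t) *\<^sub>R i + (s - t) *\<^sub>R k"
  proof -
    have "q x = 2 * t" by (simp add: q_eq t_def)
    then show ?thesis by (simp add: \<xi>_def m_def algebra_simps)
  qed
  moreover have "s + t = x \<bullet> i" "s - t = x \<bullet> k" by (simp_all add: s_def t_def field_simps)
  ultimately show ?thesis by (simp add: P_def s_def[symmetric])
qed

lemma M_horizontal: "q x = 0 \<Longrightarrow> M x x = - (P x \<bullet> P x)"
proof -
  assume "q x = 0"
  then have eq: "x \<bullet> k = x \<bullet> i" by (simp add: q_eq)
  have "P x \<bullet> P x = P x \<bullet> x" by (subst (2) P_def) (simp add: inner_diff_right)
  also have "\<dots> = x \<bullet> x - (x \<bullet> i) * (x \<bullet> i) - (x \<bullet> k) * (x \<bullet> k)"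
    by (simp add: P_def inner_diff_left inner_commute[of i x] inner_commute[of k x])
  finally show ?thesis by (simp add: minkowski_def eq)
qed

lemma P_\<Lambda>:
  assumes "g \<in> carrier G"
  shows "P (\<Lambda> g x) = q x *\<^sub>R P (\<Lambda> g m) + A g (P x)"
proof -
  have "P (\<Lambda> g x) = P (\<Lambda> g (((x \<bullet> i + x \<bullet> k) / 2) *\<^sub>R \<xi> + q x *\<^sub>R m + P x))"
    by (subst decompose[of x]) (rule refl)
  also have "\<dots> = q x *\<^sub>R P (\<Lambda> g m) + A g (P x)"
    using assms by (simp add: linear_add[OF lin] linear_scale[OF lin] fixed A_def)
  finally show ?thesis .
qed

lemma A_P: "P (A g x) = P (\<Lambda> g (P x))" by (simp add: A_def)

text \<open>\<open>\<Lambda> g\<close> preserves \<open>q\<close>, and on \<open>q x = 0\<close> the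
  form is \<open>- (P x \<bullet> P x)\<close>, so \<open>\<Lambda> g\<close> followed by
  \<open>P\<close> is isometric on the range of \<open>P\<close>.\<close>

lemma orth_A:
  assumes g: "g \<in> carrier G"
  shows "orthogonal_transformation (A g)"
  unfolding orthogonal_transformation
proof (intro conjI allI)
  show "linear (A g)"
    by (rule linearI) (simp_all add: A_def linear_add[OF lin[OF g]] linear_scale[OF lin[OF g]] algebra_simps)
  fix x
  define y where "y = \<Lambda> g (P x)"
  have "M y y = - (P y \<bullet> P y)" by (rule M_horizontal) (simp add: y_def g)
  moreover have "M y y = M (P x) (P x)" by (simp add: y_def isometry g)
  ultimately have yx: "P y \<bullet> P y = P x \<bullet> P x" by (simp add: M_horizontal)
  have ortho: "P z \<bullet> (x - P x) = 0" for z
    by (simp add: P_def[of x] inner_diff_right inner_add_right)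
  have "A g x \<bullet> A g x = P y \<bullet> P y + (x - P x) \<bullet> (x - P x)"
    unfolding A_def y_def[symmetric]
    by (simp only: inner_add_left inner_add_right ortho inner_commute[of "x - P x" "P y"]
        add_0_left add_0_right)
  also have "\<dots> = (P x + (x - P x)) \<bullet> (P x + (x - P x))"
    unfolding yx by (simp only: inner_add_left inner_add_right ortho inner_commute[of "x - P x" "P x"]
        add_0_left add_0_right)
  finally show "norm (A g x) = norm x" by (simp add: norm_eq_sqrt_inner)
qed

text \<open>If the shear had a component \<open>z\<close> fixed by \<open>A g\<close>, then moving along \<open>z\<close> would change the
  displacement by multiples of \<open>\<xi>\<close>, and some displacement would become null.\<close>

lemma shear_in_range_if_transversal:
  assumes g: "g \<in> carrier G" and a: "q (\<tau> g) \<noteq> 0"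
  shows "\<exists>y. P (\<Lambda> g m) = A g y - y"
proof -
  define b where "b = P (\<Lambda> g m)"
  have linA: "linear (A g)" using orth_A[OF g] by (rule orthogonal_transformation_linear)
  have "subspace (range (\<lambda>y. A g y - y))"
    by (intro linear_subspace_image linear_compose_sub linA linear_id[unfolded id_def] subspace_UNIV)
  then have span: "span (range (\<lambda>y. A g y - y)) = range (\<lambda>y. A g y - y)" by (simp add: span_eq_iff)
  obtain r z where r: "r \<in> range (\<lambda>y. A g y - y)" "\<And>w. w \<in> range (\<lambda>y. A g y - y) \<Longrightarrow> orthogonal z w"
    "b = r + z"
    using orthogonal_subspace_decomp_exists[of "range (\<lambda>y. A g y - y)" b] unfolding span by metis
  obtain y where y: "r = A g y - y" using r(1) by blast
  have z_perp: "z \<bullet> (A g x - x) = 0" for x using r(2) by (auto simp: orthogonal_def)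
  have "(A g z - z) \<bullet> (A g z - z) = A g z \<bullet> A g z - z \<bullet> z - 2 * (z \<bullet> (A g z - z))"
    by (simp add: algebra_simps inner_commute)
  also have "\<dots> = 0" using orth_A[OF g] by (simp add: z_perp orthogonal_transformation_def)
  finally have Az: "A g z = z" by simp
  have Pz: "P z = z"
  proof -
    have "z = b - (A g y - y)" using r(3) y by simp
    then show ?thesis by (simp add: b_def A_P) (simp add: A_def)
  qed
  have bz: "b \<bullet> z = z \<bullet> z"
    using z_perp[of y] r(3) y by (metis add_0 inner_add_right inner_commute)
  have z0: "z \<bullet> i = 0" "z \<bullet> k = 0" using P_inner[of z] Pz by simp_all
  then have qz: "q z = 0" by (simp add: q_eq)
  \<comment> \<open>\<open>\<Lambda> g z\<close> differs from \<open>z\<close> only by a multiple of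
    \<open>\<xi>\<close>; comparing \<open>M m z = 0\<close> with its value after applying
    \<open>\<Lambda> g\<close> identifies the factor as \<open>z \<bullet> z\<close>.\<close>
  define \<kappa> where "\<kappa> = (\<Lambda> g z \<bullet> i + \<Lambda> g z \<bullet> k) / 2"
  have \<Lambda>z: "\<Lambda> g z = \<kappa> *\<^sub>R \<xi> + z"
    using decompose[of "\<Lambda> g z"] P_\<Lambda>[OF g, of z] by (simp add: \<kappa>_def g qz Pz Az)
  have "M (\<Lambda> g m) z = - (\<Lambda> g m \<bullet> z)" by (simp add: minkowski_def z0)
  also have "\<Lambda> g m \<bullet> z = b \<bullet> z"
    using z0 by (simp add: b_def P_def inner_diff_left inner_commute[of i z] inner_commute[of k z])
  finally have "M (\<Lambda> g m) (\<Lambda> g z) = \<kappa> * q (\<Lambda> g m) - z \<bullet> z"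
    by (simp add: \<Lambda>z bz q_def minkowski_sym[of i "\<Lambda> g m" \<xi>])
  moreover have "M m z = 0"
    using z0 by (simp add: minkowski_def m_def inner_diff_left inner_commute[of i z] inner_commute[of k z])
  then have "M (\<Lambda> g m) (\<Lambda> g z) = 0" by (simp add: isometry g)
  ultimately have \<kappa>: "\<kappa> = z \<bullet> z" using g by simp
  have "\<kappa> = 0"
  proof (rule ccontr)
    assume "\<kappa> \<noteq> 0"
    have g1: "g \<noteq> \<one>"
    proof
      assume "g = \<one>"
      then have "\<Lambda> g z = z" by simp
      then show False using \<Lambda>z \<open>\<kappa> \<noteq> 0\<close> \<xi>_i by auto
    qed
    \<comment> \<open>For this \<open>s\<close> the displacement of \<open>s *\<^sub>R z\<close>
      would be null; solving for it uses \<open>q (\<tau> g) \<noteq> 0\<close>.\<close>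
    define s where "s = - M (\<tau> g) (\<tau> g) / (2 * \<kappa> * q (\<tau> g))"
    have "\<Lambda> g (s *\<^sub>R z) + \<tau> g - s *\<^sub>R z = (s * \<kappa>) *\<^sub>R \<xi> + \<tau> g"
      by (simp add: linear_scale[OF lin[OF g]] \<Lambda>z algebra_simps)
    then have "M ((s * \<kappa>) *\<^sub>R \<xi> + \<tau> g) ((s * \<kappa>) *\<^sub>R \<xi> + \<tau> g) < 0"
      using spacelike[OF g g1, of "s *\<^sub>R z"] by (simp only:)
    then have "2 * s * \<kappa> * q (\<tau> g) + M (\<tau> g) (\<tau> g) < 0"
      by (simp add: null q_def minkowski_sym[of i "\<tau> g" \<xi>] mult.assoc mult.left_commute)
    then show False using a \<open>\<kappa> \<noteq> 0\<close> by (simp add: s_def)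
  qed
  then have "z = 0" using \<kappa> by simp
  then show ?thesis using r(3) y by (auto simp: b_def)
qed

lemma virtually_abelian_if_fixed_null: "virtually_abelian G"
proof -
  interpret horospherical_action G A "\<lambda>g. q (\<tau> g)" "\<lambda>g. P (\<Lambda> g m)" "\<lambda>g. P (\<tau> g)" \<delta>
  proof unfold_locales
    fix g h x assume g: "g \<in> carrier G" and h: "h \<in> carrier G"
    have P\<Lambda>P: "P (\<Lambda> g (\<Lambda> h (P x))) = P (\<Lambda> g (P (\<Lambda> h (P x))))"
      using P_\<Lambda>[OF g, of "\<Lambda> h (P x)"] h by (simp add: A_def)
    show "A (g \<otimes> h) x = A g (A h x)"
      using g h by (simp add: A_def \<Lambda>_mult P\<Lambda>P)
    show "P (\<Lambda> (g \<otimes> h) m) = A g (P (\<Lambda> h m)) + P (\<Lambda> g m)"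
      using P_\<Lambda>[OF g, of "\<Lambda> h m"] g h by (simp add: \<Lambda>_mult)
    show "P (\<tau> (g \<otimes> h)) = A g (P (\<tau> h)) + q (\<tau> h) *\<^sub>R P (\<Lambda> g m) + P (\<tau> g)"
      using P_\<Lambda>[OF g, of "\<tau> h"] g h by (simp add: \<tau>_mult)
    show "q (\<tau> (g \<otimes> h)) = q (\<tau> g) + q (\<tau> h)" using g h by (simp add: \<tau>_mult)
  next
    fix g assume g: "g \<in> carrier G" "g \<noteq> \<one>" "q (\<tau> g) = 0"
    \<comment> \<open>When \<open>q (\<tau> g) = 0\<close>, projecting by \<open>P\<close> subtracts
      a null vector, so the gap to the cone bounds the projection from below. A gap to the origin
      alone would not.\<close>
    have "P (\<tau> g) = \<tau> g - (\<tau> g \<bullet> i) *\<^sub>R \<xi>"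
      using g(3) by (simp add: P_def q_eq \<xi>_def algebra_simps)
    then show "\<delta> \<le> norm (P (\<tau> g))"
      using separated[OF g(1,2), of "(\<tau> g \<bullet> i) *\<^sub>R \<xi>"] null by simp
  qed (simp_all add: orth_A shear_in_range_if_transversal \<delta>_pos)
  show ?thesis by (rule virtually_abelian)
qed

end

theorem virtually_abelian_spacelike: "virtually_abelian G"
proof (cases "bounded (L ` carrier G)")
  case False
  then obtain \<zeta> where \<zeta>: "\<zeta> \<noteq> 0" "M \<zeta> \<zeta> = 0" "\<And>g. g \<in> carrier G \<Longrightarrow> \<Lambda> g \<zeta> = \<zeta>"
    using unbounded_imp_fixed_null by blast
  have \<zeta>_i: "\<zeta> \<bullet> i \<noteq> 0" using \<zeta>(1,2) by (auto simp: minkowski_def)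
  have \<zeta>_\<zeta>: "\<zeta> \<bullet> \<zeta> = 2 * (\<zeta> \<bullet> i) * (\<zeta> \<bullet> i)" using \<zeta>(2) by (simp add: minkowski_def)
  define k where "k = (1 / (\<zeta> \<bullet> i)) *\<^sub>R \<zeta> - i"
  show ?thesis
  proof (rule virtually_abelian_if_fixed_null)
    show "k \<bullet> i = 0" using \<zeta>_i by (simp add: k_def inner_diff_left)
    show "k \<bullet> k = 1"
      using \<zeta>_i by (simp add: k_def inner_diff inner_commute[of i \<zeta>] \<zeta>_\<zeta>)
    show "\<Lambda> g (i + k) = i + k" if "g \<in> carrier G" for g
      using that by (simp add: k_def linear_scale[OF lin] \<zeta>(3))
  qed
qed (rule virtually_abelian_if_bounded)

end

section \<open>The fundamental group of the quotient\<close>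

lemma homotopic_with_concat_paths:
  assumes "homotopic_with (\<lambda>h. h 0 = p \<and> h 1 = p) (top_of_set {0..1}) X f f'"
    and "homotopic_with (\<lambda>h. h 0 = p \<and> h 1 = p) (top_of_set {0..1}) X g g'"
  shows "homotopic_with (\<lambda>h. h 0 = p \<and> h 1 = p) (top_of_set {0..1}) X
    (concat_paths f g) (concat_paths f' g')"
proof -
  let ?I = "top_of_set {0..1::real}"
  obtain F where F: "continuous_map (prod_topology ?I ?I) X F" "\<And>x. F (0, x) = f x" "\<And>x. F (1, x) = f' x"
    "\<And>t. t \<in> {0..1} \<Longrightarrow> F (t, 0) = p \<and> F (t, 1) = p"
    using assms(1) unfolding homotopic_with_def by auto
  obtain H where H: "continuous_map (prod_topology ?I ?I) X H" "\<And>x. H (0, x) = g x" "\<And>x. H (1, x) = g' x"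
    "\<And>t. t \<in> {0..1} \<Longrightarrow> H (t, 0) = p \<and> H (t, 1) = p"
    using assms(2) unfolding homotopic_with_def by auto
  let ?P = "top_of_set ({0..1::real} \<times> {0..1::real})"
  have P: "prod_topology ?I ?I = ?P" by (simp add: prod_topology_subtopology_eu)
  define K where "K z = (if snd z \<le> 1/2 then F (fst z, 2 * snd z) else H (fst z, 2 * snd z - 1))" for z
  have "continuous_map ?P X K"
    unfolding K_def
  proof (rule continuous_map_cases_le)
    show "continuous_map ?P euclideanreal snd" "continuous_map ?P euclideanreal (\<lambda>x. 1/2)"
      by (auto simp: continuous_on_snd)
    have 1: "continuous_map (subtopology ?P {x \<in> topspace ?P. snd x \<le> 1/2}) ?P (\<lambda>z. (fst z, 2 * snd z))"
      by (auto simp: subtopology_subtopology intro!: continuous_intros)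
    show "continuous_map (subtopology ?P {x \<in> topspace ?P. snd x \<le> 1/2}) X (\<lambda>z. F (fst z, 2 * snd z))"
      using continuous_map_compose[OF 1 F(1)[unfolded P]] by (simp add: comp_def)
    have 2: "continuous_map (subtopology ?P {x \<in> topspace ?P. 1/2 \<le> snd x}) ?P (\<lambda>z. (fst z, 2 * snd z - 1))"
      by (auto simp: subtopology_subtopology intro!: continuous_intros)
    show "continuous_map (subtopology ?P {x \<in> topspace ?P. 1/2 \<le> snd x}) X (\<lambda>z. H (fst z, 2 * snd z - 1))"
      using continuous_map_compose[OF 2 H(1)[unfolded P]] by (simp add: comp_def)
    show "F (fst z, 2 * snd z) = H (fst z, 2 * snd z - 1)" if "z \<in> topspace ?P" "snd z = 1/2" for z
    proof -
      have "fst z \<in> {0..1}" "2 * snd z = 1" using that by auto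
      then show ?thesis using F(4) H(4) by simp
    qed
  qed
  then show ?thesis
    unfolding homotopic_with_def P
    by (intro exI[of _ K]) (auto simp: K_def F H concat_paths_def)
qed

text \<open>Continuity comes from concatenating constant homotopies.\<close>

lemma concat_paths_in_loops_at:
  assumes "f \<in> loops_at X p" "g \<in> loops_at X p"
  shows "concat_paths f g \<in> loops_at X p"
proof -
  have "homotopic_with (\<lambda>h. h 0 = p \<and> h 1 = p) (top_of_set {0..1}) X (concat_paths f g) (concat_paths f g)"
    using assms by (intro homotopic_with_concat_paths) (auto simp: loops_at_def pathin_def homotopic_with_refl)
  from homotopic_with_imp_continuous_maps[OF this] show ?thesis
    using assms by (simp add: loops_at_def pathin_def concat_paths_def)
qed

lemma equiv_loop_homotopy: "equiv (loops_at X p) (loop_homotopy X p)"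
  unfolding equiv_def refl_on_def sym_def trans_def loop_homotopy_def
  by (auto simp: loops_at_def pathin_def homotopic_with_refl
      intro: homotopic_with_symD homotopic_with_trans)

lemma fundamental_group_mult:
  assumes "f \<in> loops_at X p" "g \<in> loops_at X p"
  shows "loop_homotopy X p `` {f} \<otimes>\<^bsub>fundamental_group X p\<^esub> loop_homotopy X p `` {g}
    = loop_homotopy X p `` {concat_paths f g}"
proof -
  let ?R = "loop_homotopy X p"
  have eq: "?R `` {concat_paths f' g'} = ?R `` {concat_paths f g}"
    if "f' \<in> ?R `` {f}" "g' \<in> ?R `` {g}" for f' g'
  proof -
    have "(concat_paths f g, concat_paths f' g') \<in> ?R"
      using that by (auto simp: loop_homotopy_def intro!: homotopic_with_concat_paths concat_paths_in_loops_at)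
    then show ?thesis using equiv_class_eq[OF equiv_loop_homotopy] by metis
  qed
  have ne: "?R `` {f} \<noteq> {}" "?R `` {g} \<noteq> {}"
    using equiv_class_self[OF equiv_loop_homotopy assms(1)]
      equiv_class_self[OF equiv_loop_homotopy assms(2)] by auto
  have "(\<Union>f'\<in>?R `` {f}. \<Union>g'\<in>?R `` {g}. ?R `` {concat_paths f' g'})
      = (\<Union>f'\<in>?R `` {f}. \<Union>g'\<in>?R `` {g}. ?R `` {concat_paths f g})"
    by (intro SUP_cong refl eq)
  also have "\<dots> = ?R `` {concat_paths f g}" unfolding UN_constant if_not_P[OF ne(1)] if_not_P[OF ne(2)] ..
  finally show ?thesis by (simp add: fundamental_group_def)
qed

section \<open>Path lifting and loops in the orbit space\<close>

locale free_proper_action =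
  fixes \<Gamma> :: "('a::euclidean_space \<Rightarrow> 'a) set"
  assumes id_mem: "id \<in> \<Gamma>"
    and comp_mem: "\<lbrakk>g \<in> \<Gamma>; h \<in> \<Gamma>\<rbrakk> \<Longrightarrow> g \<circ> h \<in> \<Gamma>"
    and bij: "g \<in> \<Gamma> \<Longrightarrow> bij g"
    and inv_mem: "g \<in> \<Gamma> \<Longrightarrow> inv_into UNIV g \<in> \<Gamma>"
    and cont: "g \<in> \<Gamma> \<Longrightarrow> continuous_on UNIV g"
    and free: "\<lbrakk>g \<in> \<Gamma>; g v = v\<rbrakk> \<Longrightarrow> g = id"
    and proper: "compact K \<Longrightarrow> finite {g \<in> \<Gamma>. g ` K \<inter> K \<noteq> {}}"
begin

abbreviation \<kappa> :: "'a \<Rightarrow> 'a set" where "\<kappa> \<equiv> orbit_map \<Gamma>"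
abbreviation X :: "'a set topology" where "X \<equiv> orbit_space \<Gamma>"

lemma inv_apply [simp]: "g \<in> \<Gamma> \<Longrightarrow> inv_into UNIV g (g x) = x"
  by (rule inv_f_f[OF bij_is_inj[OF bij]])

lemma apply_inv [simp]: "g \<in> \<Gamma> \<Longrightarrow> g (inv_into UNIV g x) = x"
  by (rule surj_f_inv_f[OF bij_is_surj[OF bij]])

lemma orbit_map_invariant: "g \<in> \<Gamma> \<Longrightarrow> \<kappa> (g x) = \<kappa> x"
proof -
  assume g: "g \<in> \<Gamma>"
  have "h x \<in> (\<lambda>h. h (g x)) ` \<Gamma>" if "h \<in> \<Gamma>" for h
    by (rule image_eqI[OF _ comp_mem[OF that inv_mem[OF g]]]) (simp add: g)
  moreover have "h (g x) \<in> (\<lambda>h. h x) ` \<Gamma>" if "h \<in> \<Gamma>" for h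
    by (rule image_eqI[OF _ comp_mem[OF that g]]) simp
  ultimately show ?thesis by (auto simp: orbit_map_def)
qed

lemma orbit_map_eq: "\<kappa> x = \<kappa> y \<longleftrightarrow> (\<exists>g\<in>\<Gamma>. x = g y)"
proof
  assume "\<kappa> x = \<kappa> y"
  moreover have "x \<in> \<kappa> x" unfolding orbit_map_def by (rule image_eqI[OF _ id_mem]) simp
  ultimately show "\<exists>g\<in>\<Gamma>. x = g y" by (auto simp: orbit_map_def)
qed (auto simp: orbit_map_invariant)

lemma continuous_orbit_map: "continuous_map euclidean X \<kappa>"
  by (rule quotient_imp_continuous_map[OF quotient_map_orbit_map])

lemma open_orbit_map_image:
  assumes "open U"
  shows "openin X (\<kappa> ` U)"
proof -
  have "\<kappa> -` \<kappa> ` U = (\<Union>g\<in>\<Gamma>. g -` U)"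
  proof (intro equalityI subsetI)
    fix x assume "x \<in> \<kappa> -` \<kappa> ` U"
    then obtain y where "y \<in> U" "\<kappa> y = \<kappa> x" by auto
    then show "x \<in> (\<Union>g\<in>\<Gamma>. g -` U)" by (auto simp: orbit_map_eq)
  next
    fix x assume "x \<in> (\<Union>g\<in>\<Gamma>. g -` U)"
    then obtain g where "g \<in> \<Gamma>" "g x \<in> U" by auto
    then show "x \<in> \<kappa> -` \<kappa> ` U" using orbit_map_invariant[of g x] by (metis imageI vimageI2)
  qed
  moreover have "open (g -` U)" if "g \<in> \<Gamma>" for g
    using cont[OF that] assms by (simp add: continuous_on_open_vimage)
  ultimately show ?thesis by (auto simp: openin_orbit_space)
qed

text \<open>By properness only finitely many elements carry a point of the closed unit ball back
  into it, and each nontrivial one moves \<open>u\<close> by a positive distance.\<close>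

lemma injective_neighbourhood: "\<exists>r>0. inj_on \<kappa> (ball u r)"
proof -
  define S where "S = {g \<in> \<Gamma>. g ` cball u 1 \<inter> cball u 1 \<noteq> {}} - {id}"
  have S: "finite S" unfolding S_def using proper[of "cball u 1"] by simp
  have "\<exists>r>0. \<forall>x\<in>ball u r. g x \<notin> ball u r" if "g \<in> S" for g
  proof -
    have g: "g \<in> \<Gamma>" "g u \<noteq> u" using that free by (auto simp: S_def)
    \<comment> \<open>A third, so that two errors of this size stay below the displacement of
      \<open>u\<close>.\<close>
    then have d: "dist (g u) u / 3 > 0" (is "?d > 0") by simp
    from cont[OF g(1)] obtain r where r: "r > 0" "\<And>x. dist x u < r \<Longrightarrow> dist (g x) (g u) < ?d"
      using d unfolding continuous_on_iff by (metis UNIV_I)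
    have "g x \<notin> ball u (min r ?d)" if x: "x \<in> ball u (min r ?d)" for x
    proof
      assume "g x \<in> ball u (min r ?d)"
      then have "dist (g x) u < ?d" by (simp add: dist_commute)
      moreover have "dist (g x) (g u) < ?d" using r(2)[of x] x by (simp add: dist_commute)
      ultimately have "dist (g u) u < ?d + ?d" by (metis add_strict_mono dist_commute dist_triangle_less_add)
      then show False using d by simp
    qed
    then show ?thesis using r(1) d by (intro exI[of _ "min r ?d"]) auto
  qed
  then obtain r where r: "\<And>g. g \<in> S \<Longrightarrow> r g > 0" "\<And>g x. g \<in> S \<Longrightarrow> x \<in> ball u (r g) \<Longrightarrow> g x \<notin> ball u (r g)"
    by metis
  define R where "R = Min (insert 1 (r ` S))"
  have R: "R > 0" "R \<le> 1" "\<And>g. g \<in> S \<Longrightarrow> R \<le> r g" using S r by (auto simp: R_def)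
  have "inj_on \<kappa> (ball u R)"
  proof (rule inj_onI)
    fix x y assume xy: "x \<in> ball u R" "y \<in> ball u R" "\<kappa> x = \<kappa> y"
    then obtain g where g: "g \<in> \<Gamma>" "x = g y" by (auto simp: orbit_map_eq)
    have "g = id"
    proof (rule ccontr)
      assume "g \<noteq> id"
      then have "g \<in> S" using g xy R(2) by (force simp: S_def)
      then show False using r(2)[of g y] R(3)[of g] g xy by auto
    qed
    then show "x = y" using g by simp
  qed
  then show ?thesis using R by blast
qed

text \<open>Bisection for the property that lifts over \<open>{a..b}\<close> exist from every
  initial point of the fibre; the free choice of initial point lets lifts be joined. Locally a lift
  is an inverse of the orbit map on a small ball, followed by the group element that matches the
  initial point.\<close>

lemma path_lifting:
  assumes "pathin X f" "f 0 = \<kappa> v"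
  shows "\<exists>c. continuous_on {0..1} c \<and> c 0 = v \<and> (\<forall>t\<in>{0..1}. f t = \<kappa> (c t))"
proof -
  have f: "continuous_map (top_of_set {0..1}) X f" using assms by (simp add: pathin_def)
  define P where "P a b \<longleftrightarrow> (0 \<le> a \<and> b \<le> 1 \<longrightarrow> (\<forall>v. f a = \<kappa> v \<longrightarrow>
      (\<exists>c. continuous_on {a..b} c \<and> c a = v \<and> (\<forall>t\<in>{a..b}. f t = \<kappa> (c t)))))" for a b :: real
  have "P 0 1"
  proof (rule Bolzano[of 0 1 P])
    fix a b d :: real assume ab: "P a b" and bd: "P b d" and le: "a \<le> b" "b \<le> d"
    show "P a d"
      unfolding P_def
    proof (intro impI allI)
      fix v assume "0 \<le> a \<and> d \<le> 1" and v: "f a = \<kappa> v"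
      then have "0 \<le> a" "b \<le> 1" "0 \<le> b" "d \<le> 1" using le by auto
      then obtain c where c: "continuous_on {a..b} c" "c a = v" "\<And>t. t \<in> {a..b} \<Longrightarrow> f t = \<kappa> (c t)"
        using ab v unfolding P_def by metis
      then obtain e where e: "continuous_on {b..d} e" "e b = c b" "\<And>t. t \<in> {b..d} \<Longrightarrow> f t = \<kappa> (e t)"
        using bd \<open>0 \<le> b\<close> \<open>d \<le> 1\<close> le unfolding P_def by (metis atLeastAtMost_iff order_refl)
      have "continuous_on ({a..b} \<union> {b..d}) (\<lambda>t. if t \<le> b then c t else e t)"
        by (rule continuous_on_cases) (use c(1) e(1,2) in auto)
      moreover have "{a..b} \<union> {b..d} = {a..d}" using le by auto
      ultimately show "\<exists>c. continuous_on {a..d} c \<and> c a = v \<and> (\<forall>t\<in>{a..d}. f t = \<kappa> (c t))"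
        using c e le by (intro exI[of _ "\<lambda>t. if t \<le> b then c t else e t"]) auto
    qed
  next
    fix x :: real assume x: "0 \<le> x" "x \<le> 1"
    then have "f x \<in> topspace X" using f by (auto simp: continuous_map_def)
    then obtain u where u: "f x = \<kappa> u" by (auto simp: topspace_orbit_space)
    obtain r where r: "r > 0" "inj_on \<kappa> (ball u r)" using injective_neighbourhood by blast
    let ?s = "inv_into (ball u r) \<kappa>"
    have "openin (top_of_set {0..1}) {t \<in> {0..1}. f t \<in> \<kappa> ` ball u r}"
      using openin_continuous_map_preimage[OF f open_orbit_map_image[of "ball u r"]] by simp
    moreover have "x \<in> {t \<in> {0..1}. f t \<in> \<kappa> ` ball u r}" using x u r by auto
    ultimately obtain d where d: "d > 0" "\<And>t. t \<in> {0..1} \<Longrightarrow> dist t x < d \<Longrightarrow> f t \<in> \<kappa> ` ball u r"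
      unfolding openin_euclidean_subtopology_iff by blast
    have "P a b" if ab: "a \<le> x" "x \<le> b" "b - a < d" for a b
      unfolding P_def
    proof (intro impI allI)
      fix v assume I: "0 \<le> a \<and> b \<le> 1" and v: "f a = \<kappa> v"
      have ft: "f t \<in> \<kappa> ` ball u r" if "t \<in> {a..b}" for t
        by (rule d(2)) (use that ab I in \<open>auto simp: dist_real_def\<close>)
      have "\<kappa> v = \<kappa> (?s (f a))" using ft[of a] ab v by (simp add: f_inv_into_f)
      then obtain g where g: "g \<in> \<Gamma>" "v = g (?s (f a))" by (auto simp: orbit_map_eq)
      have cs: "continuous_on {a..b} (\<lambda>t. ?s (f t))"
        unfolding continuous_on_open_invariant
      proof (intro allI impI)
        fix B :: "'a set" assume "open B"
        then have "openin (top_of_set {0..1}) {t \<in> {0..1}. f t \<in> \<kappa> ` (B \<inter> ball u r)}"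
          using openin_continuous_map_preimage[OF f open_orbit_map_image[of "B \<inter> ball u r"]]
          by (simp add: open_Int)
        then obtain O' where O': "open O'" "{t \<in> {0..1}. f t \<in> \<kappa> ` (B \<inter> ball u r)} = {0..1} \<inter> O'"
          by (auto simp: openin_open)
        have "t \<in> O' \<longleftrightarrow> ?s (f t) \<in> B" if t: "t \<in> {a..b}" for t
        proof -
          obtain y where y: "y \<in> ball u r" "f t = \<kappa> y" using ft[OF t] by blast
          have "t \<in> O' \<longleftrightarrow> f t \<in> \<kappa> ` (B \<inter> ball u r)"
          proof -
            have "t \<in> {0..1}" using t I by auto
            then show ?thesis using O'(2) by blast
          qed
          also have "\<dots> \<longleftrightarrow> y \<in> B"
          proof
            assume "f t \<in> \<kappa> ` (B \<inter> ball u r)"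
            then obtain z where z: "z \<in> B" "z \<in> ball u r" "\<kappa> z = \<kappa> y" using y(2) by auto
            then show "y \<in> B" using inj_onD[OF r(2) z(3,2) y(1)] by blast
          qed (use y in blast)
          finally show ?thesis using inv_into_f_f[OF r(2) y(1)] y(2) by argo
        qed
        then show "\<exists>A. open A \<and> A \<inter> {a..b} = (\<lambda>t. ?s (f t)) -` B \<inter> {a..b}"
          using O'(1) by (intro exI[of _ O']) auto
      qed
      have "continuous_on {a..b} (\<lambda>t. g (?s (f t)))"
        by (rule continuous_on_compose2[OF cont[OF g(1)] cs]) simp
      moreover have "f t = \<kappa> (g (?s (f t)))" if "t \<in> {a..b}" for t
        using ft[OF that] g(1) by (simp add: orbit_map_invariant f_inv_into_f)
      ultimately show "\<exists>c. continuous_on {a..b} c \<and> c a = v \<and> (\<forall>t\<in>{a..b}. f t = \<kappa> (c t))"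
        using g(2) by (intro exI[of _ "\<lambda>t. g (?s (f t))"]) auto
    qed
    then show "\<exists>d>0. \<forall>a b. a \<le> x \<and> x \<le> b \<and> b - a < d \<longrightarrow> P a b"
      using d(1) by blast
  qed simp
  then show ?thesis using assms(2) unfolding P_def by simp
qed

definition straight_loop :: "'a \<Rightarrow> ('a \<Rightarrow> 'a) \<Rightarrow> real \<Rightarrow> 'a set" where
  "straight_loop v g t = \<kappa> (v + t *\<^sub>R (g v - v))"

text \<open>The straight-line homotopy in \<open>V\<close> fixes the end points \<open>v\<close> and
  \<open>g v\<close>, which \<open>\<kappa>\<close> identifies.\<close>

lemma homotopic_straight_loop:
  assumes g: "g \<in> \<Gamma>" and c: "continuous_on {0..1} c" "c 0 = v" "c 1 = g v"
    and f: "\<And>t. t \<in> {0..1} \<Longrightarrow> f t = \<kappa> (c t)"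
  shows "(f, straight_loop v g) \<in> loop_homotopy X (\<kappa> v)"
proof -
  let ?I = "top_of_set {0..1::real}"
  have P: "prod_topology ?I ?I = top_of_set ({0..1} \<times> {0..1})" by (simp add: prod_topology_subtopology_eu)
  define K where "K z = (1 - fst z) *\<^sub>R c (snd z) + fst z *\<^sub>R (v + snd z *\<^sub>R (g v - v))" for z :: "real \<times> real"
  have "continuous_on ({0..1} \<times> {0..1}) (\<lambda>z :: real \<times> real. c (snd z))"
    by (rule continuous_on_compose2[OF c(1)]) (auto intro!: continuous_intros)
  then have "continuous_on ({0..1} \<times> {0..1}) K"
    unfolding K_def by (intro continuous_intros) auto
  then have "continuous_map (prod_topology ?I ?I) X (\<kappa> \<circ> K)"
    unfolding P by (intro continuous_map_compose[OF _ continuous_orbit_map]) simp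
  moreover have "K (t, 0) = v" "K (t, 1) = g v" for t
    by (simp_all add: K_def c algebra_simps)
  ultimately have hom: "homotopic_with (\<lambda>h. h 0 = \<kappa> v \<and> h 1 = \<kappa> v) ?I X f (straight_loop v g)"
    by (subst homotopic_with, simp)
      (intro exI[of _ "\<kappa> \<circ> K"], auto simp: f straight_loop_def orbit_map_invariant g, auto simp: K_def)
  then show ?thesis
    using homotopic_with_imp_continuous_maps[OF hom] homotopic_with_imp_property[OF hom]
    by (auto simp: loop_homotopy_def loops_at_def pathin_def)
qed

lemma straight_loop_in_loops_at:
  assumes "g \<in> \<Gamma>"
  shows "straight_loop v g \<in> loops_at X (\<kappa> v)"
proof -
  have "(straight_loop v g, straight_loop v g) \<in> loop_homotopy X (\<kappa> v)"
    by (rule homotopic_straight_loop[OF assms, of "\<lambda>t. v + t *\<^sub>R (g v - v)"])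
      (auto intro!: continuous_intros simp: straight_loop_def)
  then show ?thesis by (simp add: loop_homotopy_def)
qed

definition deck_group :: "('a \<Rightarrow> 'a) monoid" where
  "deck_group = \<lparr>carrier = \<Gamma>, mult = (\<circ>), one = id\<rparr>"

lemma group_deck_group: "group deck_group"
proof (rule groupI)
  fix g assume "g \<in> carrier deck_group"
  then show "\<exists>h\<in>carrier deck_group. h \<otimes>\<^bsub>deck_group\<^esub> g = \<one>\<^bsub>deck_group\<^esub>"
    by (intro bexI[of _ "inv_into UNIV g"]) (auto simp: deck_group_def inv_mem fun_eq_iff)
qed (auto simp: deck_group_def id_mem comp_mem comp_assoc)

text \<open>The concatenation lifts to the segment from \<open>v\<close> to \<open>g v\<close>
  followed by the \<open>g\<close>-image of the segment from \<open>v\<close> to \<open>h v\<close>,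
  which ends at \<open>g (h v)\<close>.\<close>

lemma concat_straight_loops:
  assumes g: "g \<in> \<Gamma>" and h: "h \<in> \<Gamma>"
  shows "(concat_paths (straight_loop v g) (straight_loop v h), straight_loop v (g \<circ> h))
    \<in> loop_homotopy X (\<kappa> v)"
proof (rule homotopic_straight_loop)
  define c where "c t = (if t \<le> 1/2 then v + (2 * t) *\<^sub>R (g v - v)
      else g (v + (2 * t - 1) *\<^sub>R (h v - v)))" for t :: real
  have "continuous_on {1/2..1} (\<lambda>t. g (v + (2 * t - 1) *\<^sub>R (h v - v)))"
    by (rule continuous_on_compose2[OF cont[OF g]]) (auto intro!: continuous_intros)
  then have "continuous_on ({0..1/2} \<union> {1/2..1}) c"
    unfolding c_def
  proof (intro continuous_on_cases allI impI)
    fix t :: real assume "t \<in> {0..1/2} \<and> \<not> t \<le> 1/2 \<or> t \<in> {1/2..1} \<and> t \<le> 1/2"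
    then have "2 * t = 1" by auto
    then show "v + (2 * t) *\<^sub>R (g v - v) = g (v + (2 * t - 1) *\<^sub>R (h v - v))" by simp
  qed (auto intro!: continuous_intros)
  moreover have "{0..1/2} \<union> {1/2..1} = {0..1::real}" by auto
  ultimately show "continuous_on {0..1} c" by simp
  show "c 0 = v" "c 1 = (g \<circ> h) v" by (simp_all add: c_def)
  show "concat_paths (straight_loop v g) (straight_loop v h) t = \<kappa> (c t)" for t
    by (simp add: concat_paths_def straight_loop_def c_def orbit_map_invariant g)
qed (simp add: comp_mem g h)

lemma virtually_abelian_fundamental_group:
  assumes va: "virtually_abelian deck_group" and p: "p \<in> topspace X"
  shows "virtually_abelian (fundamental_group X p)"
proof -
  obtain v where v: "p = \<kappa> v" using p by (auto simp: topspace_orbit_space)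
  let ?R = "loop_homotopy X p"
  define \<Phi> where "\<Phi> g = ?R `` {straight_loop v g}" for g
  note eq = equiv_class_eq[OF equiv_loop_homotopy[of X p]]
  note loop = straight_loop_in_loops_at[of _ v, folded v]
  show ?thesis
  proof (rule virtually_abelian_epi[OF va])
    show "\<Phi> \<in> hom deck_group (fundamental_group X p)"
    proof (rule homI)
      fix g assume "g \<in> carrier deck_group"
      then show "\<Phi> g \<in> carrier (fundamental_group X p)"
        by (simp add: deck_group_def fundamental_group_def \<Phi>_def quotientI loop)
    next
      fix g h assume "g \<in> carrier deck_group" "h \<in> carrier deck_group"
      then have gh: "g \<in> \<Gamma>" "h \<in> \<Gamma>" by (simp_all add: deck_group_def)
      show "\<Phi> (g \<otimes>\<^bsub>deck_group\<^esub> h) = \<Phi> g \<otimes>\<^bsub>fundamental_group X p\<^esub> \<Phi> h"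
        using eq[OF concat_straight_loops[OF gh, of v, folded v]]
        by (simp add: \<Phi>_def fundamental_group_mult[OF loop[OF gh(1)] loop[OF gh(2)]] deck_group_def)
    qed
    have "A \<in> \<Phi> ` \<Gamma>" if "A \<in> loops_at X p // ?R" for A
    proof -
      obtain f where f: "f \<in> loops_at X p" "A = ?R `` {f}" using \<open>A \<in> _\<close> by (auto simp: quotient_def)
      then obtain c where c: "continuous_on {0..1} c" "c 0 = v" "\<And>t. t \<in> {0..1} \<Longrightarrow> f t = \<kappa> (c t)"
        using path_lifting[of f v] v by (auto simp: loops_at_def)
      then have "\<kappa> (c 1) = \<kappa> v" using f v by (auto simp: loops_at_def)
      then obtain g where g: "g \<in> \<Gamma>" "c 1 = g v" by (auto simp: orbit_map_eq)
      have "A = \<Phi> g"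
        using eq[OF homotopic_straight_loop[OF g(1) c(1,2) g(2) c(3), folded v]] by (simp add: f \<Phi>_def)
      then show ?thesis using g by blast
    qed
    moreover have "\<Phi> ` \<Gamma> \<subseteq> loops_at X p // ?R" by (auto simp: \<Phi>_def quotientI loop)
    ultimately show "\<Phi> ` carrier deck_group = carrier (fundamental_group X p)"
      by (auto simp: deck_group_def fundamental_group_def)
    show "\<Phi> \<one>\<^bsub>deck_group\<^esub> = \<one>\<^bsub>fundamental_group X p\<^esub>"
      by (simp add: deck_group_def fundamental_group_def \<Phi>_def straight_loop_def[abs_def] v)
  qed
qed

end

section \<open>Standard coordinates, causality and the gap to the cone\<close>

text \<open>The built-in inner product is unrelated to \<open>ell\<close>. Sending an
  \<open>ell\<close>-orthonormal basis to \<open>Basis\<close> gives coordinates in which the two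
  are compatible, with \<open>i\<close> the image of \<open>e\<close>.\<close>

lemma lorentzian_form_standard:
  fixes ell :: "'a::euclidean_space \<Rightarrow> 'a \<Rightarrow> real"
  assumes "lorentzian_form ell"
  shows "\<exists>T i. linear T \<and> bij T \<and> norm (i :: 'a) = 1 \<and> (\<forall>x y. ell x y = minkowski i (T x) (T y))"
proof -
  obtain B e where ell: "bilinear ell" and B: "independent B" "span B = UNIV" "e \<in> B"
    and ortho: "\<And>b b'. b \<in> B \<Longrightarrow> b' \<in> B \<Longrightarrow> b \<noteq> b' \<Longrightarrow> ell b b' = 0"
    and sq: "ell e e = 1" "\<And>b. b \<in> B \<Longrightarrow> b \<noteq> e \<Longrightarrow> ell b b = -1"
    using assms unfolding lorentzian_form_def by (metis Diff_iff singletonD)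
  have "finite B" "card B = card (Basis :: 'a set)"
    using B(1,2) by (simp_all add: independent_bound_general basis_card_eq_dim[of B UNIV] flip: dim_UNIV)
  then obtain f where f: "bij_betw f B (Basis :: 'a set)"
    using finite_same_card_bij finite_Basis by blast
  obtain T where T: "linear T" "\<And>b. b \<in> B \<Longrightarrow> T b = f b"
    using linear_independent_extend[OF B(1), of f] by blast
  have "span (T ` B) = T ` span B" using T(1) by (rule linear_span_image)
  moreover have "T ` B = Basis" using f T(2) by (simp add: bij_betw_def)
  ultimately have surj: "surj T" using B(2) by simp
  then have "inj T" using T(1) by (simp add: linear_surjective_imp_injective)
  then have "bij T" using surj by (simp add: bij_def)
  have fB: "f b \<in> Basis" if "b \<in> B" for b using f that by (auto simp: bij_betw_def)
  have inj: "f b = f b' \<longleftrightarrow> b = b'" if "b \<in> B" "b' \<in> B" for b b'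
    using f that by (auto simp: bij_betw_def inj_on_def)
  have "ell b b' = minkowski (f e) (T b) (T b')" if b: "b \<in> B" "b' \<in> B" for b b'
  proof (cases "b = b'")
    case True
    then show ?thesis using sq b B(3) inj[of b e]
      by (cases "b = e") (simp_all add: minkowski_def T(2) inner_Basis fB)
  next
    case False
    then show ?thesis using ortho[OF b False] b B(3) inj
      by (simp add: minkowski_def T(2) inner_Basis fB) blast
  qed
  moreover have "bilinear (\<lambda>x y. minkowski (f e) (T x) (T y))"
    unfolding bilinear_def
    by (auto intro!: linearI simp: linear_add[OF T(1)] linear_scale[OF T(1)])
  ultimately have "ell x y = minkowski (f e) (T x) (T y)" for x y
    using bilinear_eq[OF ell, of "\<lambda>x y. minkowski (f e) (T x) (T y)" UNIV B UNIV B] B(2) by auto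
  moreover have "norm (f e) = 1" using fB[OF B(3)] by simp
  ultimately show ?thesis using T(1) \<open>bij T\<close> by blast
qed

context free_proper_action begin

text \<open>The segment from \<open>v\<close> to \<open>g v\<close> projects to a closed timelike
  path, which is nonconstant by local injectivity of \<open>\<kappa>\<close>.\<close>

lemma causal_imp_no_closed_segment:
  assumes causal: "causal \<Gamma> C" and g: "g \<in> \<Gamma>" and w: "g v - v \<in> C"
  shows "g = id"
proof (rule ccontr)
  assume "g \<noteq> id"
  define w where "w = g v - v"
  have w0: "w \<noteq> 0" using free[OF g, of v] \<open>g \<noteq> id\<close> by (auto simp: w_def)
  define c where "c s = v + s *\<^sub>R w" for s :: real
  define \<eta> where "\<eta> s = \<kappa> (c s)" for s
  have deriv: "(c has_vector_derivative w) F" for F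
    unfolding c_def has_vector_derivative_def by (auto intro!: derivative_eq_intros)
  have cont: "continuous_on S c" for S
    unfolding c_def by (intro continuous_intros)
  have smooth: "smooth_on_interval c a b" for a b
    unfolding smooth_on_interval_def
    by (rule exI[of _ "\<lambda>k. if k = 0 then c else if k = 1 then (\<lambda>_. w) else (\<lambda>_. 0)"])
      (auto simp: deriv)
  have piecewise: "piecewise_smooth_timelike C c a b" for a b
    unfolding piecewise_smooth_timelike_def using smooth cont deriv w[folded w_def]
    by (intro conjI exI[of _ "{}"]) (auto intro!: bexI[of _ w])
  have "continuous_map (top_of_set {0..1}) X (\<kappa> \<circ> c)"
    by (intro continuous_map_compose[OF _ continuous_orbit_map]) (simp add: cont)
  then have "pathin X \<eta>" by (simp add: pathin_def \<eta>_def[abs_def] comp_def)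
  then have "timelike_path \<Gamma> C \<eta>"
    unfolding timelike_path_def using piecewise 
    by (intro conjI ballI exI[of _ 1] exI[of _ c]) (auto simp: \<eta>_def)
  moreover have "\<eta> 0 = \<eta> 1" using orbit_map_invariant[OF g, of v] by (simp add: \<eta>_def c_def w_def)
  moreover have "\<exists>t\<in>{0..1}. \<eta> t \<noteq> \<eta> 0"
  proof -
    obtain r where r: "r > 0" "inj_on \<kappa> (ball v r)" using injective_neighbourhood by blast
    define t where "t = min 1 (r / (2 * norm w))"
    have t: "0 < t" "t \<le> 1" "t * norm w < r"
    proof -
      show "0 < t" "t \<le> 1" using r(1) w0 by (auto simp: t_def)
      have "t * norm w \<le> r / (2 * norm w) * norm w" by (intro mult_right_mono) (auto simp: t_def)
      then show "t * norm w < r" using r(1) w0 by simp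
    qed
    have "c t \<in> ball v r" "v \<in> ball v r" "c t \<noteq> v"
      using t r(1) w0 by (auto simp: c_def dist_norm)
    then have "\<eta> t \<noteq> \<kappa> v" unfolding \<eta>_def using inj_onD[OF r(2)] by blast
    moreover have "\<eta> 0 = \<kappa> v" by (simp add: \<eta>_def c_def)
    ultimately show ?thesis using t by (intro bexI[of _ t]) auto
  qed
  ultimately show False using causal unfolding causal_def by blast
qed

text \<open>If \<open>g\<^sub>n v + d\<^sub>n\<close> tends to \<open>v\<close> with \<open>d\<^sub>n \<in> D\<close> unbounded of limit direction \<open>e\<close>, then \<open>d\<^sub>n\<close> can be
  shortened by \<open>s\<close> inside the cone, so \<open>v - s e\<close> lies in the closure of the orbit of \<open>v + D\<close>. By local
  closedness it lies in that orbit itself, a causality violation.\<close>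

lemma orbit_separated_from_cone:
  assumes D: "closed D" "convex D" "cone D" "D \<inter> uminus ` D = {0}"
    and affine: "\<And>g. g \<in> \<Gamma> \<Longrightarrow> \<exists>L. linear L \<and> (\<forall>x. g x = L x + g 0) \<and> L ` D = D"
    and acausal: "\<And>g x. \<lbrakk>g \<in> \<Gamma>; g x - x \<in> uminus ` D\<rbrakk> \<Longrightarrow> g = id"
    and W: "openin X W" "\<kappa> v \<in> W" "W \<subseteq> U"
    and F: "closedin (subtopology X U) (U \<inter> \<kappa> ` {v + w | w. w \<in> D})"
  shows "\<exists>\<delta>>0. \<forall>g\<in>\<Gamma>. g \<noteq> id \<longrightarrow> (\<forall>d\<in>D. \<delta> \<le> norm (g v + d - v))"
proof (rule ccontr)
  assume contra: "\<not> ?thesis"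
  have scale: "r *\<^sub>R x \<in> D" if "x \<in> D" "r \<ge> 0" for x r
    using D(3) that unfolding cone_def by blast
  have add: "x + y \<in> D" if "x \<in> D" "y \<in> D" for x y
    using convex_cone[of D] D that by blast
  have translate: "\<exists>w\<in>D. g v + d = g (v + w)" if g: "g \<in> \<Gamma>" "d \<in> D" for g d
  proof -
    obtain L where L: "linear L" "\<And>x. g x = L x + g 0" "L ` D = D" using affine[OF g(1)] by blast
    then obtain w where "w \<in> D" "d = L w" using g(2) by blast
    then show ?thesis using linear_add[OF L(1), of v w] L(2)[of v] L(2)[of "v + w"] by (intro bexI[of _ w]) simp_all
  qed
  \<comment> \<open>For bounded \<open>d\<close> the point \<open>g v\<close> stays in a compact
    ball, so properness leaves finitely many \<open>g\<close>; acausality keeps each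
    \<open>v - g v\<close> out of the closed set \<open>D\<close>, hence at a positive
    distance.\<close>
  have far: "\<exists>\<epsilon>>0. \<forall>g\<in>\<Gamma>. g \<noteq> id \<longrightarrow> (\<forall>d\<in>D. norm (g v + d - v) < \<epsilon> \<longrightarrow> norm d > R)" for R
  proof -
    define K where "K = cball v (\<bar>R\<bar> + 1)"
    define S where "S = {g \<in> \<Gamma>. g ` K \<inter> K \<noteq> {}} - {id}"
    have S: "finite S" unfolding S_def K_def using proper[of "cball v (\<bar>R\<bar> + 1)"] by simp
    have "\<exists>\<epsilon>>0. \<forall>d\<in>D. \<epsilon> \<le> norm (g v + d - v)" if "g \<in> S" for g
    proof -
      have "v - g v \<notin> D"
      proof
        assume "v - g v \<in> D"
        then have "g v - v \<in> uminus ` D" by (intro image_eqI[of _ _ "v - g v"]) auto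
        then show False using acausal that by (auto simp: S_def)
      qed
      then obtain \<epsilon> where "\<epsilon> > 0" "\<forall>d\<in>D. \<epsilon> \<le> dist (v - g v) d"
        using separate_point_closed[OF D(1)] by blast
      moreover have "dist (v - g v) d = norm (g v + d - v)" for d
        by (simp add: dist_norm norm_minus_commute algebra_simps)
      ultimately show ?thesis by auto
    qed
    then obtain \<epsilon> where \<epsilon>: "\<And>g. g \<in> S \<Longrightarrow> \<epsilon> g > 0" "\<And>g d. g \<in> S \<Longrightarrow> d \<in> D \<Longrightarrow> \<epsilon> g \<le> norm (g v + d - v)"
      by metis
    define E where "E = Min (insert 1 (\<epsilon> ` S))"
    have E: "E > 0" "E \<le> 1" "\<And>g. g \<in> S \<Longrightarrow> E \<le> \<epsilon> g" using S \<epsilon>(1) by (auto simp: E_def)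
    have "norm d > R" if g: "g \<in> \<Gamma>" "g \<noteq> id" "d \<in> D" "norm (g v + d - v) < E" for g d
    proof (rule ccontr)
      assume "\<not> norm d > R"
      have "dist v (g v) \<le> norm (g v + d - v) + norm d"
        using norm_triangle_ineq4[of "g v + d - v" d] by (simp add: dist_norm norm_minus_commute)
      also have "\<dots> \<le> \<bar>R\<bar> + 1" using g(4) E(2) \<open>\<not> norm d > R\<close> by linarith
      finally have "g v \<in> K" "v \<in> K" by (simp_all add: K_def)
      then have "g \<in> S" using g by (auto simp: S_def)
      then show False using \<epsilon>(2)[OF _ g(3)] E(3) g(4) by fastforce
    qed
    then show ?thesis using E(1) by blast
  qed
  have "\<exists>g d. g \<in> \<Gamma> \<and> g \<noteq> id \<and> d \<in> D \<and> norm (g v + d - v) < 1 / real (Suc n) \<and> norm d > real n" for n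
  proof -
    obtain \<epsilon> where \<epsilon>: "\<epsilon> > 0"
      "\<And>g d. \<lbrakk>g \<in> \<Gamma>; g \<noteq> id; d \<in> D; norm (g v + d - v) < \<epsilon>\<rbrakk> \<Longrightarrow> norm d > real n"
      using far[of "real n"] by blast
    then have "min \<epsilon> (1 / real (Suc n)) > 0" by simp
    then obtain g d where "g \<in> \<Gamma>" "g \<noteq> id" "d \<in> D" "norm (g v + d - v) < min \<epsilon> (1 / real (Suc n))"
      using contra by (meson not_le)
    then show ?thesis using \<epsilon>(2) by (intro exI[of _ g] exI[of _ d]) auto
  qed
  then obtain g d where gd: "\<And>n. g n \<in> \<Gamma>" "\<And>n. d n \<in> D"
    "\<And>n. norm (g n v + d n - v) < 1 / real (Suc n)" "\<And>n. norm (d n) > real n" by metis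
  have d0: "norm (d n) > 0" for n using gd(4)[of n] by (meson of_nat_0_le_iff order_le_less_trans)
  define e where "e n = (1 / norm (d n)) *\<^sub>R d n" for n
  have "e n \<in> sphere 0 1 \<inter> D" for n using d0[of n] by (auto simp: e_def intro!: scale gd(2))
  moreover have "compact (sphere 0 1 \<inter> D)" using D(1) by (intro compact_Int_closed compact_sphere)
  ultimately obtain c r where c: "c \<in> sphere 0 1 \<inter> D" "strict_mono r" "(e \<circ> r) \<longlonglongrightarrow> c"
    unfolding compact_def by blast
  have lim: "(\<lambda>n. g (r n) v + d (r n)) \<longlonglongrightarrow> v"
  proof -
    have "norm (g n v + d n - v) \<le> inverse (real (Suc n))" for n
      using gd(3)[of n] by (simp only: inverse_eq_divide less_imp_le)
    then have "(\<lambda>n. g n v + d n - v) \<longlonglongrightarrow> 0"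
      by (intro Lim_null_comparison[OF always_eventually LIMSEQ_inverse_real_of_nat]) blast
    then have "(\<lambda>n. g n v + d n) \<longlonglongrightarrow> v" by (rule LIM_zero_cancel)
    then show ?thesis using LIMSEQ_subseq_LIMSEQ[of "\<lambda>n. g n v + d n", OF _ c(2)] by (simp add: comp_def)
  qed
  have "open (\<kappa> -` W)" using W(1) by (simp add: openin_orbit_space)
  moreover have "((\<lambda>s. v - s *\<^sub>R c) \<longlongrightarrow> v - 0 *\<^sub>R c) (at_right 0)" by (intro tendsto_intros)
  ultimately have "\<forall>\<^sub>F s in at_right 0. v - s *\<^sub>R c \<in> \<kappa> -` W"
    using W(2) by (intro topological_tendstoD) auto
  with eventually_at_right_less[of "0 :: real"]
  have "\<forall>\<^sub>F s in at_right 0. s > 0 \<and> v - s *\<^sub>R c \<in> \<kappa> -` W" by (rule eventually_conj)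
  then obtain s where s: "s > 0" "v - s *\<^sub>R c \<in> \<kappa> -` W"
    using eventually_happens'[OF trivial_limit_at_right_real] by blast
  \<comment> \<open>\<open>d (r n)\<close> is shortened by length \<open>s\<close>; for large
    \<open>n\<close> the factor is nonnegative, so \<open>y n\<close> stays in the orbit of
    \<open>v + D\<close>.\<close>
  define y where "y n = g (r n) v + (1 - s / norm (d (r n))) *\<^sub>R d (r n)" for n
  have "y n = (g (r n) v + d (r n)) - s *\<^sub>R (e \<circ> r) n" for n
    by (simp add: y_def e_def algebra_simps)
  then have y: "y \<longlonglongrightarrow> v - s *\<^sub>R c" using tendsto_diff[OF lim tendsto_scaleR[OF tendsto_const c(3)]]
    by presburger
  obtain Z where Z: "closedin X Z" "U \<inter> \<kappa> ` {v + w | w. w \<in> D} = Z \<inter> U"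
    using F by (auto simp: closedin_subtopology)
  have "closed (\<kappa> -` Z)"
    using closedin_continuous_map_preimage[OF continuous_orbit_map Z(1)] by (simp add: vimage_def)
  moreover have "\<forall>\<^sub>F n in sequentially. y n \<in> \<kappa> -` Z"
  proof -
    have "\<forall>\<^sub>F n in sequentially. y n \<in> \<kappa> -` W"
      by (rule topological_tendstoD[OF y \<open>open (\<kappa> -` W)\<close> s(2)])
    moreover have "\<forall>\<^sub>F n in sequentially. real n \<ge> s" 
      using filterlim_real_sequentially by (simp add: filterlim_at_top)
    ultimately show ?thesis
    proof eventually_elim
      case (elim n)
      have "s \<le> norm (d (r n))" using elim(2) gd(4)[of "r n"] seq_suble[OF c(2), of n] by linarith
      then have "(1 - s / norm (d (r n))) *\<^sub>R d (r n) \<in> D"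
        using d0[of "r n"] by (intro scale gd(2)) (simp add: field_simps)
      then obtain w where "w \<in> D" "y n = g (r n) (v + w)" using translate gd(1) unfolding y_def by blast
      then have "\<kappa> (y n) \<in> \<kappa> ` {v + w | w. w \<in> D}" using orbit_map_invariant[OF gd(1)] by auto
      then show ?case using elim(1) W(3) Z(2) by blast
    qed
  qed
  ultimately have "v - s *\<^sub>R c \<in> \<kappa> -` Z"
    using Lim_in_closed_set[OF _ _ sequentially_bot y] by blast
  then have "\<kappa> (v - s *\<^sub>R c) \<in> \<kappa> ` {v + w | w. w \<in> D}" using s(2) W(3) Z(2) by blast
  then obtain w h where w: "w \<in> D" "h \<in> \<Gamma>" "v - s *\<^sub>R c = h (v + w)" by (auto simp: orbit_map_eq)
  obtain L where L: "linear L" "\<And>x. h x = L x + h 0" "L ` D = D" using affine[OF w(2)] by blast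
  have sc: "s *\<^sub>R c \<in> D" using c(1) s(1) by (intro scale) auto
  \<comment> \<open>The displacement of \<open>v\<close> under \<open>h\<close> lies in
    \<open>- D\<close>, so \<open>h\<close> is the identity, which places
    \<open>s *\<^sub>R c\<close> in both \<open>D\<close> and \<open>- D\<close>.\<close>
  have eq: "h v - v = - (s *\<^sub>R c + L w)"
    using w(3) by (simp add: L(2)[of v] L(2)[of "v + w"] linear_add[OF L(1)] algebra_simps)
  have Lw: "L w \<in> D" using L(3) w(1) by blast
  have "h v - v \<in> uminus ` D" unfolding eq by (intro imageI add sc Lw)
  then have "h = id" using acausal w(2) by blast
  moreover have "s *\<^sub>R c + L w = - (h v - v)" by (simp only: eq minus_minus)
  ultimately have "s *\<^sub>R c = - L w" by (simp add: eq_neg_iff_add_eq_0)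
  then have "s *\<^sub>R c \<in> D \<inter> uminus ` D" using sc Lw by blast
  then have "s *\<^sub>R c = 0" using D(4) by blast
  then show False using s(1) c(1) by auto
qed

end

lemma lorentz_affine_linear_part:
  assumes "lorentz_affine ell C g"
  shows "linear (\<lambda>v. g v - g 0)" "ell (g x - g 0) (g y - g 0) = ell x y"
    "(\<lambda>v. g v - g 0) ` C = C"
proof -
  obtain L t where L: "linear L" "\<And>v. g v = L v + t" "\<And>x y. ell (L x) (L y) = ell x y" "L ` C = C"
    using assms unfolding lorentz_affine_def by metis
  have "(\<lambda>v. g v - g 0) = L" using L(1,2) by (simp add: fun_eq_iff linear_0)
  then show "linear (\<lambda>v. g v - g 0)" "ell (g x - g 0) (g y - g 0) = ell x y" "(\<lambda>v. g v - g 0) ` C = C"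
    using L(1,3,4) by (auto simp: fun_eq_iff)
qed

lemma acts_freely_properly_imp_free_proper_action:
  assumes "acts_freely_properly ell C \<Gamma>"
  shows "free_proper_action \<Gamma>"
proof -
  have cont: "continuous_on UNIV g" if "g \<in> \<Gamma>" for g
  proof -
    have "lorentz_affine ell C g" using that assms unfolding acts_freely_properly_def by blast
    then have "linear (\<lambda>v. g v - g 0)" by (rule lorentz_affine_linear_part(1))
    then have "continuous_on UNIV (\<lambda>v. (g v - g 0) + g 0)"
      by (intro continuous_on_add linear_continuous_on continuous_on_const)
        (simp add: linear_conv_bounded_linear[symmetric])
    then show ?thesis by simp
  qed
  note acts = assms[unfolded acts_freely_properly_def]
  show ?thesis
  proof unfold_locales
    show "id \<in> \<Gamma>" using acts by (elim conjE)
    show "g \<circ> h \<in> \<Gamma>" if "g \<in> \<Gamma>" "h \<in> \<Gamma>" for g h using acts that by (elim conjE) blast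
    show "bij g" "inv_into UNIV g \<in> \<Gamma>" if "g \<in> \<Gamma>" for g using acts that by (elim conjE, blast)+
    show "continuous_on UNIV g" if "g \<in> \<Gamma>" for g using that by (rule cont)
    show "g = id" if "g \<in> \<Gamma>" "g v = v" for g v using acts that by (elim conjE) blast
    show "finite {g \<in> \<Gamma>. g ` K \<inter> K \<noteq> {}}" if "compact K" for K using acts that by (elim conjE) blast
  qed
qed

theorem virtually_abelian_deck_group:
  fixes ell :: "'a::euclidean_space \<Rightarrow> 'a \<Rightarrow> real"
  assumes form: "lorentzian_form ell" and cone: "time_cone ell C"
    and acts: "acts_freely_properly ell C \<Gamma>" and sc: "strictly_causal \<Gamma> C"
  shows "virtually_abelian (free_proper_action.deck_group \<Gamma>)"
proof -
  interpret free_proper_action \<Gamma> by (rule acts_freely_properly_imp_free_proper_action[OF acts])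
  have affine: "lorentz_affine ell C g" if "g \<in> \<Gamma>" for g
    using acts that unfolding acts_freely_properly_def by blast
  note part = lorentz_affine_linear_part[OF affine]
  have C: "closed C" "convex C" "cone C" "C \<inter> uminus ` C = {0}" and C_eq: "{v. ell v v \<ge> 0} = C \<union> uminus ` C"
    using cone unfolding time_cone_def by auto
  have C_uminus: "uminus ` uminus ` C = C" by (simp add: image_image)
  have future: "g = id" if "g \<in> \<Gamma>" "g v - v \<in> C" for g v
    using causal_imp_no_closed_segment that sc unfolding strictly_causal_def by blast
  \<comment> \<open>The inverse of \<open>g\<close> displaces \<open>g v\<close> by a vector of
    \<open>C\<close>.\<close>
  have past: "g = id" if g: "g \<in> \<Gamma>" "g v - v \<in> uminus ` C" for g v
  proof -
    obtain x where "x \<in> C" "g v - v = - x" using g(2) by blast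
    then have "inv_into UNIV g (g v) - g v \<in> C" using g(1) by (metis inv_apply minus_diff_eq minus_minus)
    then have "inv_into UNIV g = id" using future inv_mem g(1) by blast
    then have "inv_into UNIV g (g v) = g v" by simp
    then show ?thesis using free[of g v] g(1) by simp
  qed
  obtain U W where U: "openin X W" "\<kappa> 0 \<in> W" "W \<subseteq> U"
    "closedin (subtopology X U) (U \<inter> future_of \<Gamma> C 0)" "closedin (subtopology X U) (U \<inter> past_of \<Gamma> C 0)"
    using sc unfolding strictly_causal_def by blast
  \<comment> \<open>\<open>D = C\<close> bounds \<open>g 0\<close> away from \<open>- C\<close>, and
    \<open>D = - C\<close> below bounds it away from \<open>C\<close>: closedness of the future
    controls one half of the cone, closedness of the past the other.\<close>
  have "\<exists>\<delta>>0. \<forall>g\<in>\<Gamma>. g \<noteq> id \<longrightarrow> (\<forall>d\<in>C. \<delta> \<le> norm (g 0 + d - 0))"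
  proof (rule orbit_separated_from_cone[OF C _ _ U(1-3)])
    show "\<exists>L. linear L \<and> (\<forall>x. g x = L x + g 0) \<and> L ` C = C" if "g \<in> \<Gamma>" for g
      using part(1,3)[OF that] by (intro exI[of _ "\<lambda>v. g v - g 0"]) simp
    show "closedin (subtopology X U) (U \<inter> \<kappa> ` {0 + w | w. w \<in> C})"
      using U(4) unfolding future_of_def .
  qed (rule past)
  then obtain \<delta>1 where \<delta>1: "\<delta>1 > 0" "\<And>g d. \<lbrakk>g \<in> \<Gamma>; g \<noteq> id; d \<in> C\<rbrakk> \<Longrightarrow> \<delta>1 \<le> norm (g 0 + d)" by auto
  have "\<exists>\<delta>>0. \<forall>g\<in>\<Gamma>. g \<noteq> id \<longrightarrow> (\<forall>d\<in>uminus ` C. \<delta> \<le> norm (g 0 + d - 0))"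
  proof (rule orbit_separated_from_cone[OF _ _ _ _ _ _ U(1-3)])
    show "closed (uminus ` C)" "convex (uminus ` C)" using C by (simp_all add: closed_negations convex_negations)
    show "cone (uminus ` C)"
      unfolding cone_def
    proof (intro ballI allI impI)
      fix x and r :: real assume "x \<in> uminus ` C" "0 \<le> r"
      then obtain y where "y \<in> C" "x = - y" by blast
      then have "r *\<^sub>R y \<in> C" "r *\<^sub>R x = - (r *\<^sub>R y)" using C(3) \<open>0 \<le> r\<close> by (auto simp: cone_def)
      then show "r *\<^sub>R x \<in> uminus ` C" by blast
    qed
    show "uminus ` C \<inter> uminus ` uminus ` C = {0}" using C(4) by (simp only: C_uminus Int_commute)
    show "\<exists>L. linear L \<and> (\<forall>x. g x = L x + g 0) \<and> L ` uminus ` C = uminus ` C" if "g \<in> \<Gamma>" for g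
    proof (intro exI conjI allI)
      let ?L = "\<lambda>v. g v - g 0"
      show "linear ?L" by (rule part(1)[OF that])
      show "g x = ?L x + g 0" for x by simp
      have "?L ` uminus ` C = uminus ` ?L ` C"
        unfolding image_image using linear_neg[OF part(1)[OF that]] by (intro image_cong) auto
      then show "?L ` uminus ` C = uminus ` C" by (simp only: part(3)[OF that])
    qed
    show "g = id" if "g \<in> \<Gamma>" "g x - x \<in> uminus ` uminus ` C" for g x
      using future that unfolding C_uminus by blast
    have "{0 - w | w. w \<in> C} = {0 + w | w. w \<in> uminus ` C}" by auto
    then show "closedin (subtopology X U) (U \<inter> \<kappa> ` {0 + w | w. w \<in> uminus ` C})"
      using U(5) unfolding past_of_def by simp
  qed
  then obtain \<delta>2 where \<delta>2: "\<delta>2 > 0" "\<And>g d. \<lbrakk>g \<in> \<Gamma>; g \<noteq> id; d \<in> C\<rbrakk> \<Longrightarrow> \<delta>2 \<le> norm (g 0 - d)" by auto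
  define \<delta> where "\<delta> = min \<delta>1 \<delta>2"
  have \<delta>: "\<delta> > 0" using \<delta>1(1) \<delta>2(1) by (simp add: \<delta>_def)
  have sep: "\<delta> \<le> norm (g 0 - z)" if "g \<in> \<Gamma>" "g \<noteq> id" "ell z z \<ge> 0" for g z
  proof -
    have "z \<in> C \<union> uminus ` C" using that(3) C_eq by blast
    then have "z \<in> C \<or> - z \<in> C" by auto
    then show ?thesis using \<delta>1(2)[OF that(1,2), of "- z"] \<delta>2(2)[OF that(1,2), of z] by (auto simp: \<delta>_def)
  qed
  have spacelike: "ell (g v - v) (g v - v) < 0" if "g \<in> \<Gamma>" "g \<noteq> id" for g v
  proof (rule ccontr)
    assume "\<not> ?thesis"
    then have "g v - v \<in> C \<union> uminus ` C" using C_eq by auto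
    then show False using future past that by blast
  qed
  obtain T and i :: 'a where T: "linear T" "bij T" "norm i = 1" "\<And>x y. ell x y = minkowski i (T x) (T y)"
    using lorentzian_form_standard[OF form] by blast
  define S where "S = inv_into UNIV T"
  have ST [simp]: "S (T x) = x" and TS [simp]: "T (S x) = x" for x
    using T(2) by (simp_all add: S_def bij_is_inj bij_is_surj surj_f_inv_f)
  have S: "linear S"
    unfolding S_def using T(1,2) by (simp add: bij_def inj_linear_imp_inv_linear)
  obtain B where B: "B > 0" "\<And>x. norm (S x) \<le> B * norm x" using linear_bounded_pos[OF S] by blast
  define \<Lambda> where "\<Lambda> g x = T (g (S x) - g 0)" for g :: "'a \<Rightarrow> 'a" and x
  define \<tau> where "\<tau> g = T (g 0)" for g :: "'a \<Rightarrow> 'a"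
  have T_add: "T x + T y = T (x + y)" for x y
    using T(1) by (simp add: linear_add)
  \<comment> \<open>The gap was measured before the change of coordinates; \<open>B\<close> bounds
    the inverse \<open>S\<close>.\<close>
  interpret spacelike_displacements deck_group \<Lambda> \<tau> i "\<delta> / B"
  proof (intro spacelike_displacements.intro spacelike_displacements_axioms.intro group_deck_group)
    fix g and x y :: 'a assume "g \<in> carrier deck_group"
    then have g: "g \<in> \<Gamma>" by (simp add: deck_group_def)
    have "\<Lambda> g = T \<circ> ((\<lambda>v. g v - g 0) \<circ> S)" by (auto simp: \<Lambda>_def)
    then show "linear (\<Lambda> g)" using T(1) S part(1)[OF g] by (simp add: linear_compose)
    show "minkowski i (\<Lambda> g x) (\<Lambda> g y) = minkowski i x y"
      using part(2)[OF g, of "S x" "S y"] by (simp add: \<Lambda>_def T(4))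
  next
    fix g h and x :: 'a assume "g \<in> carrier deck_group" "h \<in> carrier deck_group"
    then have gh: "g \<in> \<Gamma>" "h \<in> \<Gamma>" by (simp_all add: deck_group_def)
    have "(g (h (S x)) - g 0) - (g (h 0) - g 0) = g (h (S x) - h 0) - g 0"
      using linear_diff[OF part(1)[OF gh(1)], of "h (S x)" "h 0"] by simp
    then show "\<Lambda> (g \<otimes>\<^bsub>deck_group\<^esub> h) x = \<Lambda> g (\<Lambda> h x)"
      by (simp add: \<Lambda>_def deck_group_def)
    show "\<tau> (g \<otimes>\<^bsub>deck_group\<^esub> h) = \<Lambda> g (\<tau> h) + \<tau> g"
      by (simp add: \<Lambda>_def \<tau>_def deck_group_def T_add)
  next
    fix g and v :: 'a assume "g \<in> carrier deck_group" "g \<noteq> \<one>\<^bsub>deck_group\<^esub>"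
    then have g: "g \<in> \<Gamma>" "g \<noteq> id" by (simp_all add: deck_group_def)
    have "\<Lambda> g v + \<tau> g - v = T (g (S v) - S v)"
      by (simp add: \<Lambda>_def \<tau>_def linear_diff[OF T(1)])
    then show "minkowski i (\<Lambda> g v + \<tau> g - v) (\<Lambda> g v + \<tau> g - v) < 0"
      using spacelike[OF g, of "S v"] by (simp add: T(4))
  next
    fix g and z :: 'a assume "g \<in> carrier deck_group" "g \<noteq> \<one>\<^bsub>deck_group\<^esub>" and z: "0 \<le> minkowski i z z"
    then have g: "g \<in> \<Gamma>" "g \<noteq> id" by (simp_all add: deck_group_def)
    have "\<delta> \<le> norm (g 0 - S z)" by (rule sep[OF g]) (simp add: T(4) z)
    also have "g 0 - S z = S (\<tau> g - z)" by (simp add: \<tau>_def linear_diff[OF S])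
    also have "norm \<dots> \<le> B * norm (\<tau> g - z)" by (rule B(2))
    finally show "\<delta> / B \<le> norm (\<tau> g - z)" using B(1) by (simp add: field_simps)
  qed (use T(3) \<delta> B(1) in simp_all)
  show ?thesis by (rule virtually_abelian_spacelike)
qed

theorem proposition1:
  fixes ell :: "'a::euclidean_space \<Rightarrow> 'a \<Rightarrow> real"
    and C :: "'a set"
    and \<Gamma> :: "('a \<Rightarrow> 'a) set"
    and p :: "'a set"
  assumes "lorentzian_form ell"
    and "time_cone ell C"
    and "acts_freely_properly ell C \<Gamma>"
    and "strictly_causal \<Gamma> C"
    and "p \<in> topspace (orbit_space \<Gamma>)"
  shows "virtually_abelian (fundamental_group (orbit_space \<Gamma>) p)"
  using free_proper_action.virtually_abelian_fundamental_group[OF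
      acts_freely_properly_imp_free_proper_action[OF assms(3)]
      virtually_abelian_deck_group[OF assms(1-4)] assms(5)] .

end
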